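(* (1) For every $x$ that is feasible for the problem defining $z_{\mathrm{DDFact}}$ (that is, $\mathbf{e}^\top x=s$, $0\le x\le\mathbf{e}$, $Ax\le b$) and in the domain of $f_{\mathrm{DDFact}}(\cdot;\Upsilon)$, the function $\Upsilon\mapsto f_{\mathrm{DDFact}}(x;\Upsilon)$ is differentiable at every $\Upsilon\in\mathbb{R}^n_{++}$. (2) In particular, in the case of MESP (no constraints $Ax\le b$), if $x^*$ is an optimal solution of $$\max\{f_{\mathrm{DDFact}}(x;\mathbf{e}) : \mathbf{e}^\top x=s,\ 0\le x\le\mathbf{e}\},$$ then $$\left.\frac{\partial f_{\mathrm{DDFact}}(x^*;\Upsilon)}{\partial\Upsilon}\right|_{\Upsilon=\mathbf{e}}=0 .$$
   Context: Let $n>1$, let $s$ be an integer with $0<s<n$, let $C\in\mathbb{R}^{n\times n}$ be symmetric positive semidefinite with $\operatorname{rank}(C)\ge s$, let $A\in\mathbb{R}^{m\times n}$, $b\in\mathbb{R}^m$, and fix a factorization $C=FF^\top$ with $F\in\mathbb{R}^{n\times k}$, $\operatorname{rank}(C)\le k\le n$. $F_{i\cdot}$ is the $i$-th row of $F$ and $\mathbf{e}$ is the all-ones vector. For $\lambda\in\mathbb{R}^k_+$ with $\lambda_1\ge\cdots\ge\lambda_k$ there is a unique integer $\iota$ with $0\le\iota<s$ and $\lambda_\iota>\frac{1}{s-\iota}\sum_{\ell=\iota+1}^k\lambda_\ell\ge\lambda_{\iota+1}$, with the convention $\lambda_0=+\infty$ (a known lemma). With this $\iota$ define $$\phi_s(\lambda):=\sum_{\ell=1}^{\iota}\log\lambda_\ell+(s-\iota)\log\Big(\frac{1}{s-\iota}\sum_{\ell=\iota+1}^k\lambda_\ell\Big)$$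 (with $\log 0=-\infty$). For a symmetric positive semidefinite $k\times k$ matrix $X$ with eigenvalues $\lambda_1(X)\ge\cdots\ge\lambda_k(X)$, let $\Gamma_s(X):=\phi_s(\lambda_1(X),\dots,\lambda_k(X))$. For $\Upsilon=(\gamma_1,\dots,\gamma_n)^\top\in\mathbb{R}^n_{++}$ (all entries positive) and $x\in[0,1]^n$, let $$F_{\mathrm{DDFact}}(x;\Upsilon):=\sum_{i=1}^n\gamma_i x_i F_{i\cdot}^\top F_{i\cdot}\in\mathbb{R}^{k\times k},\qquad f_{\mathrm{DDFact}}(x;\Upsilon):=\Gamma_s(F_{\mathrm{DDFact}}(x;\Upsilon))-\sum_{i=1}^n x_i\log\gamma_i .$$ The domain of $f_{\mathrm{DDFact}}(\cdot;\Upsilon)$ is the set of $x\in[0,1]^n$ at which this value is finite (equivalently, $\operatorname{rank}F_{\mathrm{DDFact}}(x;\Upsilon)\ge s$); it does not depend on $\Upsilon\in\mathbb{R}^n_{++}$. The g-scaled factorization bound is $$z_{\mathrm{DDFact}}(\Upsilon):=\max\{f_{\mathrm{DDFact}}(x;\Upsilon) : \mathbf{e}^\top x=s,\ 0\le x\le\mathbf{e},\ Ax\le b\}.$$ MESP denotes the case in which there are no constraints $Ax\le b$. *)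

theory Defs
  imports "HOL-Analysis.Analysis"
begin

(* ln 0 = 0 in the library, whereas log 0 = - infinity is needed here. *)
definition elog :: "real \<Rightarrow> ereal" where
  "elog t = (if 0 < t then ereal (ln t) else -\<infinity>)"

(* real_of_ereal maps infinite values to 0; demanding finiteness in a whole neighbourhood
   keeps those junk values out of the derivative. *)
definition ereal_differentiable_at :: "('a::real_normed_vector \<Rightarrow> ereal) \<Rightarrow> 'a \<Rightarrow> bool" where
  "ereal_differentiable_at g z \<longleftrightarrow>
     (\<forall>\<^sub>F y in nhds z. \<bar>g y\<bar> \<noteq> \<infinity>) \<and> (\<lambda>y. real_of_ereal (g y)) differentiable (at z)"

definition ereal_gradient_at :: "('a::real_inner \<Rightarrow> ereal) \<Rightarrow> 'a \<Rightarrow> 'a \<Rightarrow> bool" where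
  "ereal_gradient_at g z D \<longleftrightarrow>
     (\<forall>\<^sub>F y in nhds z. \<bar>g y\<bar> \<noteq> \<infinity>) \<and> (GDERIV (\<lambda>y. real_of_ereal (g y)) z :> D)"

definition sym_psd :: "real^'n^'n \<Rightarrow> bool" where
  "sym_psd X \<longleftrightarrow> transpose X = X \<and> (\<forall>v. 0 \<le> v \<bullet> (X *v v))"

definition charpoly :: "real^'k^'k \<Rightarrow> real poly" where
  "charpoly X = det (mat [:0, 1:] - map_matrix (\<lambda>a. [:a:]) X)"

(* Real eigenvalues with multiplicity in nonincreasing order, indexed from 1. A symmetric
   matrix has CARD('k) of them; other indices are not used. *)
definition eigval :: "real^'k^'k \<Rightarrow> nat \<Rightarrow> real" where
  "eigval X l = rev (sorted_list_of_multiset (proots (charpoly X))) ! (l - 1)"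

definition tail_avg :: "nat \<Rightarrow> nat \<Rightarrow> (nat \<Rightarrow> real) \<Rightarrow> nat \<Rightarrow> real" where
  "tail_avg k s lam i = (\<Sum>l=i+1..k. lam l) / (real s - real i)"

(* The disjunct i = 0 is the convention that the entry with index 0 is + infinity. *)
definition is_iota :: "nat \<Rightarrow> nat \<Rightarrow> (nat \<Rightarrow> real) \<Rightarrow> nat \<Rightarrow> bool" where
  "is_iota k s lam i \<longleftrightarrow>
     i < s \<and> (i = 0 \<or> lam i > tail_avg k s lam i) \<and> tail_avg k s lam i \<ge> lam (i + 1)"

definition iota :: "nat \<Rightarrow> nat \<Rightarrow> (nat \<Rightarrow> real) \<Rightarrow> nat" where
  "iota k s lam = (THE i. is_iota k s lam i)"

lemma ex1_is_iota:
  assumes s: "0 < s" "s \<le> k"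
    and nonneg: "\<And>l. 1 \<le> l \<Longrightarrow> l \<le> k \<Longrightarrow> 0 \<le> lam l"
    and mono: "\<And>i j. 1 \<le> i \<Longrightarrow> i \<le> j \<Longrightarrow> j \<le> k \<Longrightarrow> lam j \<le> lam i"
  shows "\<exists>!i. is_iota k s lam i"
proof (rule ex_ex1I)
  define P where "P = (\<lambda>i. i < s \<and> tail_avg k s lam i \<ge> lam (i + 1))"
  have "lam s \<le> (\<Sum>l=s..k. lam l)"
    by (rule member_le_sum) (use s nonneg in auto)
  then have "P (s - 1)"
    using s by (simp add: P_def tail_avg_def of_nat_diff)
  then have P: "P (LEAST i. P i)" by (rule LeastI)
  define i where "i = (LEAST i. P i)"
  have "lam i > tail_avg k s lam i" if "i \<noteq> 0"
  proof -
    have "\<not> P (i - 1)" using that not_less_Least[of "i - 1" P] by (simp add: i_def)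
    moreover have "i < s" using P by (simp add: P_def i_def)
    ultimately have "tail_avg k s lam (i - 1) < lam i" using that by (auto simp: P_def)
    moreover have "(\<Sum>l=i..k. lam l) = lam i + (\<Sum>l=i+1..k. lam l)"
      using \<open>i < s\<close> s by (simp add: sum.atLeast_Suc_atMost)
    ultimately show ?thesis
      using that \<open>i < s\<close> by (simp add: tail_avg_def of_nat_diff field_simps)
  qed
  then show "\<exists>i. is_iota k s lam i"
    using P unfolding i_def[symmetric] by (auto simp: is_iota_def P_def)
next
  have False if i: "is_iota k s lam i" and j: "is_iota k s lam j" and ij: "i < j" for i j
  proof -
    define a where "a = tail_avg k s lam i"
    have js: "j < s" using j by (simp add: is_iota_def)
    have a: "lam (i + 1) \<le> a" using i by (simp add: is_iota_def a_def)
    have "{i+1..k} = {i+1..j} \<union> {j+1..k}" using ij js s by auto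
    then have split: "(\<Sum>l=i+1..k. lam l) = (\<Sum>l=i+1..j. lam l) + (\<Sum>l=j+1..k. lam l)"
      by (simp only:, subst sum.union_disjoint) auto
    have "(\<Sum>l=i+1..j. lam l) \<le> (\<Sum>l=i+1..j. a)"
      by (rule sum_mono) (use mono[of "i + 1"] a js s in force)
    also have "\<dots> = (real j - real i) * a" using ij by (simp add: of_nat_diff)
    finally have "(real s - real j) * a \<le> (\<Sum>l=j+1..k. lam l)"
      using split ij js by (simp add: a_def tail_avg_def field_simps)
    then have "a \<le> tail_avg k s lam j"
      using js by (simp add: tail_avg_def field_simps)
    also have "\<dots> < lam j" using j ij by (auto simp: is_iota_def)
    also have "\<dots> \<le> lam (i + 1)" using mono[of "i + 1" j] ij js s by simp
    finally show False using a by simp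
  qed
  then show "i = j" if "is_iota k s lam i" "is_iota k s lam j" for i j
    using that by (meson linorder_neqE_nat)
qed

definition phi :: "nat \<Rightarrow> nat \<Rightarrow> (nat \<Rightarrow> real) \<Rightarrow> ereal" where
  "phi k s lam = (let i = iota k s lam in
     (\<Sum>l=1..i. elog (lam l)) + ereal (real s - real i) * elog (tail_avg k s lam i))"

definition Gam :: "nat \<Rightarrow> real^'k^'k \<Rightarrow> ereal" where
  "Gam s X = phi CARD('k) s (eigval X)"

(* The type annotation is needed: columnvector v may have any number of (equal) columns. *)
definition F_DDFact :: "real^'k^'n \<Rightarrow> real^'n \<Rightarrow> real^'n \<Rightarrow> real^'k^'k" where
  "F_DDFact F x U = (\<Sum>i\<in>UNIV. (U $ i * x $ i) *\<^sub>R
     ((columnvector (row i F) :: real^1^'k) ** (rowvector (row i F) :: real^'k^1)))"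

definition f_DDFact :: "real^'k^'n \<Rightarrow> nat \<Rightarrow> real^'n \<Rightarrow> real^'n \<Rightarrow> ereal" where
  "f_DDFact F s x U = Gam s (F_DDFact F x U) - ereal (\<Sum>i\<in>UNIV. x $ i * ln (U $ i))"

(* The orders on vectors below are componentwise, 1 is the all-ones vector. *)
definition dom_DDFact :: "real^'k^'n \<Rightarrow> nat \<Rightarrow> real^'n \<Rightarrow> (real^'n) set" where
  "dom_DDFact F s U = {x. 0 \<le> x \<and> x \<le> 1 \<and> \<bar>f_DDFact F s x U\<bar> \<noteq> \<infinity>}"

definition feasible_MESP :: "nat \<Rightarrow> (real^'n) set" where
  "feasible_MESP s = {x. 1 \<bullet> x = real s \<and> 0 \<le> x \<and> x \<le> 1}"

definition feasible :: "nat \<Rightarrow> real^'n^'m \<Rightarrow> real^'m \<Rightarrow> (real^'n) set" where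
  "feasible s A b = {x \<in> feasible_MESP s. A *v x \<le> b}"

(* The row type 'm is nonempty; an empty system of constraints is given by zero rows. *)
lemma feasible_unconstrained: "feasible s 0 0 = feasible_MESP s"
  by (simp add: feasible_def)

definition positive_vec :: "real^'n \<Rightarrow> bool" where
  "positive_vec U \<longleftrightarrow> (\<forall>i. 0 < U $ i)"

end

theory Submission
  imports Defs
begin

text \<open>
  Write \<open>\<Gamma>\<close> for \<^const>\<open>Gam\<close>. The definition of \<open>\<Gamma>\<close> through the index \<open>\<iota>\<close> hides its regularity,
  because \<open>\<iota>\<close> jumps when eigenvalues move. The proof replaces it by a variational formula. With
  \<open>h r = r\<close> for \<open>r \<le> 1\<close> and \<open>h r = 1 + ln r\<close> for \<open>r > 1\<close>, a concave function whose derivative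
  \<open>1 / max r 1\<close> is Lipschitz, one has for \<open>X\<close> positive semidefinite of rank at
  least \<open>s\<close> with eigenvalues \<open>d\<close>
  \<open>\<Gamma> X = min_{a > 0} (\<Sum>i. h (d i / a)) + s ln a - s\<close>.
  The minimum is attained exactly where \<open>\<Sum>i. min (d i) a = s a\<close>, and the average of the tail beyond
  \<open>\<iota>\<close> solves this equation (\<open>phi_cases\<close>, \<open>water_level_minimizes\<close>).

  For fixed \<open>a\<close> the minimand is the trace of a function of \<open>X\<close>. If \<open>q i, d i\<close> and \<open>r j, e j\<close> are
  orthonormal eigensystems of \<open>X\<close> and \<open>Y\<close>, then the first-order Taylor remainder of such a trace is
  the average of the scalar remainders at the pairs \<open>(d i, e j)\<close> with weights \<open>(q i \<bullet> r j)\<^sup>2\<close>, while the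
  same average of \<open>(e j - d i)\<^sup>2\<close> is the squared Frobenius norm of \<open>Y - X\<close>
  (\<open>spectral_sum_expansion\<close>, \<open>spectral_distance\<close>). Scalar bounds on \<open>h\<close> therefore give the
  upper bound by the tangent and the quadratic lower bound for matrices, without any eigenvalue
  perturbation theory. The function \<open>h\<close> is \<open>hlog\<close> below.

  Taking the minimum over \<open>a\<close> preserves differentiability as soon as a minimizing \<open>a\<close> can be chosen
  continuously (\<open>Gam_has_derivative_same_support\<close>). If \<open>X\<close> has more than \<open>s\<close> positive eigenvalues, the
  minimizer is unique and stable. If it has exactly \<open>s\<close>, every small \<open>a\<close> is a minimizer, and the
  slopes for different \<open>a\<close> disagree on the kernel of \<open>X\<close>. They agree along matrices with the same
  kernel, and this suffices, because
  \<open>\<Sum>i. w i f i (f i)\<^sup>T\<close> (with \<open>f i\<close> the rows of \<open>F\<close>) has the same kernel for all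
  \<open>w \<ge> 0\<close> of the same support, and changing the
  scaling \<open>\<gamma>\<close> keeps the support of \<open>w = \<gamma> x\<close>.

  At \<open>\<gamma> = 1\<close> the partial derivatives are \<open>x j (g j - 1)\<close>, where \<open>g j\<close> is the quadratic form of row
  \<open>j\<close> in the gradient of \<open>\<Gamma>\<close>. The numbers \<open>x j\<close> and \<open>x j g j\<close> both sum to \<open>s\<close>, and \<open>x j g j \<le> 1\<close>.
  If \<open>g j > 1\<close> for some \<open>j\<close> in the support of a maximizer \<open>x\<close>, then \<open>x j < 1\<close>, so moving mass from
  any other \<open>i\<close> in the support to \<open>j\<close> is feasible and optimality gives \<open>g i \<ge> g j > 1\<close>; then
  \<open>\<Sum>j. x j g j > s\<close>, a contradiction. Hence \<open>g \<le> 1\<close> on the support, and equality of the two sums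
  forces \<open>g = 1\<close> there.
\<close>

section \<open>Orthonormal eigensystems of symmetric matrices\<close>

text \<open>
  Cauchy-Schwarz for a positive semidefinite form: otherwise the form would be negative at
  \<open>u + t z\<close> for a suitable \<open>t\<close>. The form is restricted to a subspace because
  \<open>symmetric_has_eigenvector\<close> is used inside the orthogonal complement of eigenvectors already found.
\<close>

lemma psd_form_null:
  fixes X :: "real^'k^'k"
  assumes S: "subspace S" and sym: "transpose X = X"
    and psd: "\<And>v. v \<in> S \<Longrightarrow> 0 \<le> v \<bullet> (X *v v)"
    and u: "u \<in> S" "u \<bullet> (X *v u) = 0" and z: "z \<in> S"
  shows "z \<bullet> (X *v u) = 0"
proof (rule ccontr)
  assume nz: "z \<bullet> (X *v u) \<noteq> 0"
  define p where "p = z \<bullet> (X *v u)"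
  define c where "c = z \<bullet> (X *v z)"
  have c0: "0 \<le> c" using psd[OF z] by (simp add: c_def)
  have swap: "u \<bullet> (X *v z) = p"
    by (metis dot_lmul_matrix inner_commute p_def sym transpose_matrix_vector)
  \<comment> \<open>The minimizer of the quadratic would be \<open>- p / c\<close>; adding 1 covers \<open>c = 0\<close>.\<close>
  define t where "t = - p / (c + 1)"
  have "0 \<le> (u + t *\<^sub>R z) \<bullet> (X *v (u + t *\<^sub>R z))"
    using psd S u z by (simp add: subspace_add subspace_scale)
  also have "\<dots> = 2 * t * p + t\<^sup>2 * c"
    using u(2) swap
    by (simp add: matrix_vector_right_distrib matrix_vector_mult_scaleR inner_add_left inner_add_right
        p_def c_def power2_eq_square algebra_simps)
  also have "p = - t * (c + 1)" using c0 by (simp add: t_def)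
  also have "2 * t * (- t * (c + 1)) + t\<^sup>2 * c = - (t\<^sup>2 * (c + 2))"
    by (simp add: power2_eq_square algebra_simps)
  finally have "t\<^sup>2 * (c + 2) \<le> 0" by simp
  moreover have "0 < t\<^sup>2 * (c + 2)" using nz c0 by (simp add: p_def t_def)
  ultimately show False by linarith
qed

text \<open>
  A maximizer \<open>u\<close> of the Rayleigh quotient on the unit sphere of \<open>S\<close> is an eigenvector: with \<open>c\<close> the
  maximum, the form of \<open>c I - X\<close> is positive semidefinite on \<open>S\<close> and vanishes at \<open>u\<close>, so
  \<open>c u - X u\<close> is orthogonal to all of \<open>S\<close>, in particular to itself.
\<close>

lemma symmetric_has_eigenvector:
  fixes X :: "real^'k^'k"
  assumes S: "subspace S" and inv: "\<And>v. v \<in> S \<Longrightarrow> X *v v \<in> S" and sym: "transpose X = X"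
    and nz: "S \<noteq> {0}"
  obtains u c where "u \<in> S" "norm u = 1" "X *v u = c *\<^sub>R u"
proof -
  obtain w where w: "w \<in> S" "w \<noteq> 0" using nz S subspace_0 by blast
  define K where "K = sphere 0 1 \<inter> S"
  have "w /\<^sub>R norm w \<in> K" using w S by (simp add: K_def subspace_scale)
  then have ne: "K \<noteq> {}" by blast
  have comp: "compact K" unfolding K_def
    using S by (intro compact_Int_closed compact_sphere closed_subspace)
  have "continuous_on K (\<lambda>v. v \<bullet> (X *v v))"
    by (intro continuous_intros linear_continuous_on linear_linear[THEN iffD1] matrix_vector_mul_linear)
  then obtain u where u: "u \<in> K" and max: "\<And>v. v \<in> K \<Longrightarrow> v \<bullet> (X *v v) \<le> u \<bullet> (X *v u)"
    using continuous_attains_sup[OF comp ne] by blast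
  define c where "c = u \<bullet> (X *v u)"
  have nu: "norm u = 1" and uS: "u \<in> S" using u by (auto simp: K_def)
  define Y where "Y = c *\<^sub>R mat 1 - X"
  have Y: "Y *v v = c *\<^sub>R v - X *v v" for v
    by (simp add: Y_def matrix_vector_mult_diff_rdistrib scaleR_matrix_vector_assoc[symmetric])
  have symY: "transpose Y = Y"
    using sym by (auto simp: Y_def transpose_def vec_eq_iff mat_def)
  have psd: "0 \<le> v \<bullet> (Y *v v)" if v: "v \<in> S" for v
  proof (cases "v = 0")
    case False
    have "v /\<^sub>R norm v \<in> K" using v False S by (simp add: K_def subspace_scale)
    from max[OF this] have "v \<bullet> (X *v v) / (norm v)\<^sup>2 \<le> c"
      by (simp add: c_def matrix_vector_mult_scaleR power2_eq_square divide_simps)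
    then have "v \<bullet> (X *v v) \<le> c * (v \<bullet> v)"
      using False by (simp add: field_simps power2_norm_eq_inner)
    then show ?thesis by (simp add: Y inner_diff_right)
  qed simp
  have "u \<bullet> (Y *v u) = 0"
    using nu by (simp add: Y inner_diff_right c_def norm_eq_1)
  moreover have "Y *v u \<in> S" using uS inv S by (simp add: Y subspace_diff subspace_scale)
  ultimately have "(Y *v u) \<bullet> (Y *v u) = 0"
    using psd_form_null[OF S symY psd uS] by blast
  then have "X *v u = c *\<^sub>R u" by (simp add: Y)
  with uS nu show ?thesis by (rule that)
qed

lemma orthonormal_eigenbasis_subspace:
  fixes X :: "real^'k^'k"
  assumes sym: "transpose X = X"
  shows "subspace S \<Longrightarrow> (\<And>v. v \<in> S \<Longrightarrow> X *v v \<in> S) \<Longrightarrow>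
    \<exists>B\<subseteq>S. pairwise orthogonal B \<and> (\<forall>u\<in>B. norm u = 1 \<and> (\<exists>c. X *v u = c *\<^sub>R u)) \<and> span B = S"
proof (induction "dim S" arbitrary: S rule: less_induct)
  case less
  show ?case
  proof (cases "S = {0}")
    case True
    then show ?thesis by (intro exI[of _ "{}"]) (auto simp: pairwise_def)
  next
    case False
    from symmetric_has_eigenvector[OF less.prems sym False]
    obtain u c where u: "u \<in> S" "norm u = 1" "X *v u = c *\<^sub>R u" by blast
    define T where "T = {v \<in> S. u \<bullet> v = 0}"
    have subT: "subspace T"
      using less.prems(1) by (auto simp: T_def subspace_def inner_add_right)
    have inv: "X *v v \<in> T" if "v \<in> T" for v
    proof -
      have "u \<bullet> (X *v v) = (X *v u) \<bullet> v"
        by (metis dot_lmul_matrix sym transpose_matrix_vector)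
      then show ?thesis using that less.prems(2) u(3) by (simp add: T_def)
    qed
    have "u \<notin> T" using u by (simp add: T_def norm_eq_1)
    then have "T \<subset> S" using u(1) T_def by blast
    then have "dim T < dim S"
      by (metis dim_psubset less.prems(1) span_eq_iff subT)
    from less.hyps[OF this subT inv] obtain B where B: "B \<subseteq> T" "pairwise orthogonal B"
      "\<forall>u\<in>B. norm u = 1 \<and> (\<exists>c. X *v u = c *\<^sub>R u)" "span B = T" by blast
    have "pairwise orthogonal (insert u B)"
      using B(1,2) by (auto simp: pairwise_insert T_def orthogonal_def inner_commute)
    moreover have "S \<subseteq> span (insert u B)"
    proof
      fix v assume v: "v \<in> S"
      have "v - (u \<bullet> v) *\<^sub>R u \<in> T"
        using v u less.prems(1) by (simp add: T_def subspace_diff subspace_scale inner_diff_right norm_eq_1)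
      then show "v \<in> span (insert u B)" using B(4) by (auto simp: span_insert)
    qed
    moreover have "span (insert u B) \<subseteq> S"
      using u B(1) less.prems(1) by (intro span_minimal) (auto simp: T_def)
    ultimately show ?thesis
      using B u by (intro exI[of _ "insert u B"]) (auto simp: T_def)
  qed
qed

definition eigensystem :: "real^'k^'k \<Rightarrow> ('k \<Rightarrow> real^'k) \<Rightarrow> ('k \<Rightarrow> real) \<Rightarrow> bool" where
  "eigensystem X q d \<longleftrightarrow>
     (\<forall>i j. q i \<bullet> q j = (if i = j then 1 else 0)) \<and> (\<forall>i. X *v q i = d i *\<^sub>R q i)"

text \<open>
  The spectral theorem, with the eigenbasis indexed by the coordinates so that sums over
  eigenvalues run over a type.
\<close>

lemma symmetric_eigensystem:
  fixes X :: "real^'k^'k"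
  assumes "transpose X = X"
  obtains q d where "eigensystem X q d"
proof -
  obtain B where B: "pairwise orthogonal B" "\<And>u. u \<in> B \<Longrightarrow> norm u = 1"
    "\<And>u. u \<in> B \<Longrightarrow> \<exists>c. X *v u = c *\<^sub>R u" "span B = UNIV"
    using orthonormal_eigenbasis_subspace[OF assms, of UNIV] by auto
  have "0 \<notin> B" using B(2) by force
  then have ind: "independent B" using B(1) by (rule pairwise_orthogonal_independent[rotated])
  then have fin: "finite B" by (rule independent_imp_finite)
  have "card B = CARD('k)"
    using dim_eq_card_independent[OF ind] B(4) by (metis dim_UNIV dim_span DIM_cart DIM_real mult.right_neutral)
  then obtain q where q: "bij_betw q (UNIV :: 'k set) B"
    using finite_same_card_bij[OF finite fin] by metis
  obtain c where c: "\<And>u. u \<in> B \<Longrightarrow> X *v u = c u *\<^sub>R u" using B(3) by metis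
  have qB: "q i \<in> B" for i using q by (auto simp: bij_betw_def)
  have "q i \<bullet> q j = (if i = j then 1 else 0)" for i j
    using B(1) qB[of i] qB[of j] B(2)[of "q i"] q
    by (auto simp: pairwise_def orthogonal_def norm_eq_1 bij_betw_def inj_def)
  then have "eigensystem X q (\<lambda>i. c (q i))" using c qB by (simp add: eigensystem_def)
  then show ?thesis by (rule that)
qed

lemma eigensystem_expand:
  assumes "eigensystem X q d"
  shows "(\<Sum>i\<in>UNIV. (q i \<bullet> v) *\<^sub>R q i) = (v :: real^'k)"
proof -
  have inj: "inj q" using assms unfolding eigensystem_def inj_def
    by (metis zero_neq_one)
  have po: "pairwise orthogonal (range q)"
    using assms by (auto simp: pairwise_def orthogonal_def eigensystem_def) 
  have n1: "norm b = 1" if "b \<in> range q" for b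
    using assms that by (auto simp: norm_eq_1 eigensystem_def)
  have "0 \<notin> range q"
    using assms unfolding eigensystem_def by (metis imageE inner_zero_left zero_neq_one)
  then have "independent (range q)" using po by (rule pairwise_orthogonal_independent[rotated])
  moreover have "card (range q) = CARD('k)" using inj by (rule card_image)
  ultimately have "span (range q) = UNIV"
    by (metis DIM_cart DIM_real UNIV_I card_eq_dim dim_UNIV finite_class.finite_UNIV finite_imageI mult.right_neutral subset_UNIV top.extremum_uniqueI)
  then have "(\<Sum>b\<in>range q. (v \<bullet> b) *\<^sub>R b) = v"
    using orthonormal_basis_expand[OF po n1, of v] by simp
  then show ?thesis using inj by (simp add: sum.reindex inner_commute)
qed

lemma eigensystem_parseval:
  assumes "eigensystem X q d"
  shows "(\<Sum>i\<in>UNIV. (q i \<bullet> v) * (q i \<bullet> w)) = v \<bullet> (w :: real^'k)"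
proof -
  have "v \<bullet> w = (\<Sum>i\<in>UNIV. (q i \<bullet> v) *\<^sub>R q i) \<bullet> w"
    using eigensystem_expand[OF assms] by simp
  then show ?thesis by (simp add: inner_sum_left)
qed

lemma eigensystem_quadratic_form:
  assumes "eigensystem X q d"
  shows "v \<bullet> (X *v v) = (\<Sum>i\<in>UNIV. d i * (q i \<bullet> v)\<^sup>2)"
proof -
  have "X *v v = X *v (\<Sum>i\<in>UNIV. (q i \<bullet> v) *\<^sub>R q i)"
    using eigensystem_expand[OF assms] by simp
  also have "\<dots> = (\<Sum>i\<in>UNIV. (q i \<bullet> v) *\<^sub>R d i *\<^sub>R q i)"
    using assms by (simp add: eigensystem_def linear_sum matrix_vector_mult_scaleR)
  finally show ?thesis
    by (simp add: inner_sum_right inner_commute power2_eq_square algebra_simps)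
qed

text \<open>
  A map that kills the kernel of \<open>X\<close> is determined by its values at the eigenvectors for nonzero
  eigenvalues. Comparing ranks in this way replaces dimension counts of kernels below.
\<close>

lemma rank_le_nonzero_eigenvalues:
  fixes X :: "real^'k^'k" and A :: "real^'k^'n"
  assumes X: "eigensystem X q d" and ker: "\<And>v. X *v v = 0 \<Longrightarrow> A *v v = 0"
  shows "rank A \<le> card {i. d i \<noteq> 0}"
proof -
  let ?P = "{i. d i \<noteq> 0}"
  have 0: "A *v q i = 0" if "d i = 0" for i
    using ker[of "q i"] X that by (simp add: eigensystem_def)
  have "A *v v \<in> span ((\<lambda>i. A *v q i) ` ?P)" for v
  proof -
    have "A *v v = (\<Sum>i\<in>UNIV. (q i \<bullet> v) *\<^sub>R (A *v q i))"
      by (subst eigensystem_expand[OF X, of v, symmetric])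
         (simp add: linear_sum matrix_vector_mult_scaleR)
    also have "\<dots> = (\<Sum>i\<in>?P. (q i \<bullet> v) *\<^sub>R (A *v q i))"
      by (rule sum.mono_neutral_right) (auto simp: 0)
    also have "\<dots> \<in> span ((\<lambda>i. A *v q i) ` ?P)"
      by (intro span_sum span_scale span_base) auto
    finally show ?thesis .
  qed
  then have "range ((*v) A) \<subseteq> span ((\<lambda>i. A *v q i) ` ?P)" by blast
  then have "rank A \<le> card ((\<lambda>i. A *v q i) ` ?P)"
    unfolding rank_dim_range by (intro dim_le_card) auto
  also have "\<dots> \<le> card ?P" by (rule card_image_le) simp
  finally show ?thesis .
qed

lemma nonzero_eigenvalues_le_rank:
  fixes X :: "real^'k^'k"
  assumes X: "eigensystem X q d"
  shows "card {i. d i \<noteq> 0} \<le> rank X"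
proof -
  have inj: "inj q" using X unfolding eigensystem_def inj_def by (metis zero_neq_one)
  have po: "pairwise orthogonal (q ` {i. d i \<noteq> 0})"
    using X by (auto simp: pairwise_def orthogonal_def eigensystem_def)
  have "0 \<notin> q ` {i. d i \<noteq> 0}"
    using X unfolding eigensystem_def by (metis imageE inner_zero_left zero_neq_one)
  then have ind: "independent (q ` {i. d i \<noteq> 0})"
    using po by (rule pairwise_orthogonal_independent[rotated])
  have "q i \<in> range ((*v) X)" if "d i \<noteq> 0" for i
  proof -
    have "X *v ((1 / d i) *\<^sub>R q i) = q i"
      using X that by (simp add: matrix_vector_mult_scaleR eigensystem_def)
    then show ?thesis by (metis rangeI)
  qed
  then have "card (q ` {i. d i \<noteq> 0}) \<le> dim (range ((*v) X))"
    using ind by (intro independent_card_le_dim) auto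
  then show ?thesis
    using inj by (simp add: rank_dim_range card_image inj_on_subset)
qed

lemma map_matrix_mult_const_poly:
  fixes A :: "real^'n^'m" and B :: "real^'k^'n"
  shows "map_matrix (\<lambda>a. [:a:]) (A ** B) = map_matrix (\<lambda>a. [:a:]) A ** map_matrix (\<lambda>a. [:a:]) B"
proof -
  have "(\<Sum>x\<in>S. [:f x:]) = [:\<Sum>x\<in>S. f x:]" for f :: "'n \<Rightarrow> real" and S
    by (induction S rule: infinite_finite_induct) auto
  then show ?thesis by (simp add: vec_eq_iff matrix_matrix_mult_def mult.commute)
qed

text \<open>
  The eigenbasis diagonalizes \<open>X\<close>; the similarity is carried over to matrices of polynomials by
  embedding the entries as constant polynomials.
\<close>

lemma charpoly_eigensystem:
  fixes X :: "real^'k^'k"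
  assumes "eigensystem X q d"
  shows "charpoly X = (\<Prod>i\<in>UNIV. [:- d i, 1:])"
proof -
  let ?p = "map_matrix (\<lambda>a::real. [:a:])"
  define Q :: "real^'k^'k" where "Q = (\<chi> r c. q c $ r)"
  define D :: "real^'k^'k" where "D = (\<chi> r c. if r = c then d r else 0)"
  have QQ: "transpose Q ** Q = mat 1"
    using assms by (auto simp: vec_eq_iff matrix_matrix_mult_def transpose_def Q_def mat_def
        eigensystem_def inner_vec_def)
  have "(X *v q j) $ i = d j * q j $ i" for i j using assms by (simp add: eigensystem_def)
  then have XQ: "X ** Q = Q ** D"
    by (simp add: vec_eq_iff matrix_matrix_mult_def Q_def D_def matrix_vector_mult_def
        if_distrib[where f="\<lambda>x. _ * x"] cong: if_cong)
  have "?p (mat 1) = (mat 1 :: real poly^'k^'k)"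
    by (simp add: vec_eq_iff mat_def one_pCons)
  then have "?p (transpose Q) ** ?p Q = mat 1"
    using QQ by (simp flip: map_matrix_mult_const_poly)
  then have det1: "det (?p (transpose Q)) * det (?p Q) = 1"
    by (metis det_I det_mul)
  have swap: "mat [:0,1:] ** ?p Q = ?p Q ** mat [:0,1:]"
    by (simp add: vec_eq_iff matrix_matrix_mult_def mat_def if_distrib[where f="\<lambda>x. _ * x"]
        if_distrib[where f="\<lambda>x. x * _"] mult.commute del: mult_pCons_left mult_pCons_right cong: if_cong)
  have "(mat [:0,1:] - ?p X) ** ?p Q = mat [:0,1:] ** ?p Q - ?p X ** ?p Q"
    by (simp add: vec_eq_iff matrix_matrix_mult_def left_diff_distrib sum_subtractf del: mult_pCons_left mult_pCons_right)
  also have "\<dots> = ?p Q ** mat [:0,1:] - ?p Q ** ?p D"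
    by (simp add: swap XQ flip: map_matrix_mult_const_poly)
  also have "\<dots> = ?p Q ** (mat [:0,1:] - ?p D)"
    by (simp add: vec_eq_iff matrix_matrix_mult_def right_diff_distrib sum_subtractf del: mult_pCons_left mult_pCons_right)
  finally have "det (mat [:0,1:] - ?p X) * det (?p Q) = det (?p Q) * det (mat [:0,1:] - ?p D)"
    by (metis det_mul)
  then have "charpoly X = det (mat [:0,1:] - ?p D)"
    unfolding charpoly_def using det1
    by (metis mult.commute mult_cancel_left mult_zero_left zero_neq_one)
  also have "\<dots> = (\<Prod>i\<in>UNIV. [:- d i, 1:])"
    by (subst det_diagonal) (auto simp: mat_def D_def)
  finally show ?thesis .
qed

text \<open>
  This is how the sorted roots of the characteristic polynomial are exchanged for the eigenvalues of
  an arbitrary eigensystem: symmetric sums agree, and only order and membership are otherwise needed.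
\<close>

lemma eigval_eigensystem:
  fixes X :: "real^'k^'k"
  assumes "eigensystem X q d"
  shows "(\<Sum>l=1..CARD('k). f (eigval X l)) = (\<Sum>i\<in>UNIV. f (d i) :: real)"
    and "1 \<le> l \<Longrightarrow> l \<le> m \<Longrightarrow> m \<le> CARD('k) \<Longrightarrow> eigval X m \<le> eigval X l"
    and "1 \<le> l \<Longrightarrow> l \<le> CARD('k) \<Longrightarrow> eigval X l \<in> range d"
proof -
  define xs where "xs = rev (sorted_list_of_multiset (proots (charpoly X)))"
  have "proots (charpoly X) = (\<Sum>i\<in>UNIV. {#d i#})"
    unfolding charpoly_eigensystem[OF assms] by (subst proots_prod) auto
  also have "\<dots> = image_mset d (mset_set UNIV)"
    by (simp add: sum_unfold_sum_mset)
  finally have mset: "mset xs = image_mset d (mset_set UNIV)" by (simp add: xs_def)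
  have len: "length xs = CARD('k)" by (metis mset size_image_mset size_mset size_mset_set)
  have ev: "eigval X l = xs ! (l - 1)" for l by (simp add: eigval_def xs_def)
  have "(\<Sum>l=1..CARD('k). f (eigval X l)) = (\<Sum>l<length xs. f (xs ! l))"
    by (rule sum.reindex_bij_witness[of _ Suc "\<lambda>l. l - 1"]) (auto simp: ev len)
  also have "\<dots> = sum_list (map f xs)"
    by (simp add: sum_list_sum_nth atLeast0LessThan)
  also have "\<dots> = (\<Sum>i\<in>UNIV. f (d i))"
    by (metis (no_types, lifting) image_mset.compositionality mset mset_map sum_mset_sum_list
        sum_unfold_sum_mset comp_def multiset.map_cong)
  finally show "(\<Sum>l=1..CARD('k). f (eigval X l)) = (\<Sum>i\<in>UNIV. f (d i))" .
  have "sorted_wrt (\<ge>) xs" by (simp add: xs_def sorted_wrt_rev)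
  then show "eigval X m \<le> eigval X l" if "1 \<le> l" "l \<le> m" "m \<le> CARD('k)"
    using that len by (cases "l = m") (auto simp: ev sorted_wrt_iff_nth_less)
  show "eigval X l \<in> range d" if "1 \<le> l" "l \<le> CARD('k)"
  proof -
    have "xs ! (l - 1) \<in> set xs" using that len by simp
    also have "set xs = range d" by (metis mset set_mset_mset set_image_mset finite_set_mset_mset_set finite_class.finite_UNIV)
    finally show ?thesis by (simp add: ev)
  qed
qed

lemma eigensystem_inner:
  assumes "eigensystem X q d"
  shows "q i \<bullet> (X *v v) = d i * (q i \<bullet> v)"
proof -
  have X: "q i \<bullet> q j = (if i = j then 1 else 0)" "X *v q j = d j *\<^sub>R q j" for i j
    using assms by (auto simp: eigensystem_def)
  have "q i \<bullet> (X *v v) = q i \<bullet> (X *v (\<Sum>j\<in>UNIV. (q j \<bullet> v) *\<^sub>R q j))"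
    using eigensystem_expand[OF assms] by simp
  also have "\<dots> = (\<Sum>j\<in>UNIV. (q j \<bullet> v) * (d j * (q i \<bullet> q j)))"
    by (simp add: X(2) linear_sum matrix_vector_mult_scaleR inner_sum_right mult.assoc)
  also have "\<dots> = d i * (q i \<bullet> v)"
    by (simp add: X if_distrib[where f="\<lambda>x. _ * x"] cong: if_cong)
  finally show ?thesis .
qed

lemma eigensystem_eigenvalue:
  assumes "eigensystem X q d"
  shows "d i = q i \<bullet> (X *v q i)" and "norm (q i) = 1"
  using assms by (auto simp: eigensystem_def norm_eq_1)

section \<open>A variational formula for the spectral function\<close>

text \<open>
  The logarithm, continued to the left of 1 by its tangent; the shift by 1 makes it the identity there,
  so that it is also defined at eigenvalue 0.
\<close>

definition hlog :: "real \<Rightarrow> real" where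
  "hlog r = (if r \<le> 1 then r else 1 + ln r)"

lemma ln_ratio_le:
  fixes r r' :: real
  assumes "0 < r" "0 < r'"
  shows "ln r' \<le> ln r + (r' - r) / r"
proof -
  have "ln (r' / r) \<le> r' / r - 1" using assms by (intro ln_le_minus_one) simp
  then show ?thesis using assms by (simp add: ln_div diff_divide_distrib)
qed

lemma hlog_le_tangent: "hlog r' \<le> hlog r + (r' - r) / max r 1"
proof -
  consider "r \<le> 1" "r' \<le> 1" | "r \<le> 1" "1 < r'" | "1 < r" "r' \<le> 1" | "1 < r" "1 < r'"
    by linarith
  then show ?thesis
  proof cases
    case 2
    then show ?thesis using ln_le_minus_one[of r'] by (simp add: hlog_def max_def)
  next
    case 3
    have "r' - 1 \<le> (r' - 1) / r" 
      using 3 mult_right_mono_neg[of 1 r "r' - 1"] by (simp add: pos_le_divide_eq mult.commute)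
    moreover have "0 \<le> ln r + (1 - r) / r" using ln_ratio_le[of r 1] 3 by simp
    moreover have "(r' - r) / r = (r' - 1) / r + (1 - r) / r"
      by (simp add: add_divide_distrib[symmetric])
    ultimately show ?thesis using 3 by (simp add: hlog_def max_def)
  next
    case 4
    then show ?thesis using ln_ratio_le[of r r'] by (simp add: hlog_def max_def)
  qed (simp add: hlog_def max_def)
qed

lemma inverse_max_lipschitz:
  fixes r r' a :: real
  assumes "0 < a"
  shows "\<bar>1 / max r' a - 1 / max r a\<bar> \<le> \<bar>r' - r\<bar> / a\<^sup>2"
proof -
  let ?m = "max r a" and ?m' = "max r' a"
  have m: "a \<le> ?m" "a \<le> ?m'" by auto
  then have pos: "0 < ?m" "0 < ?m'" using assms by linarith+
  then have "\<bar>1 / ?m' - 1 / ?m\<bar> = \<bar>?m - ?m'\<bar> / (?m * ?m')"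
    by (subst diff_frac_eq) (auto simp: abs_mult mult.commute)
  also have "\<dots> \<le> \<bar>r' - r\<bar> / a\<^sup>2"
    using assms m by (intro frac_le) (auto simp: power2_eq_square intro!: mult_mono)
  finally show ?thesis .
qed

text \<open>
  The derivative \<open>1 / max r 1\<close> is Lipschitz with constant 1, so the error of the tangent is
  quadratic.
\<close>

lemma hlog_ge_tangent: "hlog r + (r' - r) / max r 1 - (r' - r)\<^sup>2 \<le> hlog r'"
proof -
  have "hlog r \<le> hlog r' + (r - r') / max r' 1" by (rule hlog_le_tangent)
  moreover have "(r' - r) * (1 / max r 1 - 1 / max r' 1) \<le> (r' - r)\<^sup>2"
  proof -
    have "(r' - r) * (1 / max r 1 - 1 / max r' 1) \<le> \<bar>r' - r\<bar> * \<bar>1 / max r' 1 - 1 / max r 1\<bar>"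
      by (metis abs_ge_self abs_minus_commute abs_mult)
    also have "\<dots> \<le> \<bar>r' - r\<bar> * \<bar>r' - r\<bar>"
      using inverse_max_lipschitz[of 1 r' r] by (intro mult_left_mono) auto
    finally show ?thesis by (simp add: power2_eq_square)
  qed
  ultimately show ?thesis by (simp add: algebra_simps diff_divide_distrib)
qed

text \<open>
  In the variable \<open>y = ln r\<close> the function \<open>hlog\<close> is convex with derivative \<open>min r 1\<close>; this is the
  tangent inequality in that variable.
\<close>

lemma hlog_log_convex:
  assumes "0 \<le> r" "0 < c"
  shows "hlog r + min r 1 * ln c \<le> hlog (r * c)"
proof -
  consider "r = 0" | "0 < r" "r \<le> 1" "r * c \<le> 1" | "0 < r" "r \<le> 1" "1 < r * c"
    | "1 < r" "r * c \<le> 1" | "1 < r" "1 < r * c"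
    using assms by linarith
  then show ?thesis
  proof cases
    case 2
    have "r * ln c \<le> r * (c - 1)"
      using 2 assms by (intro mult_left_mono ln_le_minus_one) auto
    then show ?thesis using 2 by (simp add: hlog_def algebra_simps)
  next
    case 3
    have "0 \<le> (1 - r) * ln (r * c)" using 3 by simp
    moreover have "r - 1 \<le> r * ln r"
      using ln_ratio_le[of r 1] 3 by (simp add: field_simps)
    ultimately show ?thesis using 3 assms by (simp add: hlog_def ln_mult algebra_simps)
  next
    case 4
    then show ?thesis using ln_le_minus_one[of "r * c"] assms by (simp add: hlog_def ln_mult)
  next
    case 5
    then show ?thesis using assms by (simp add: hlog_def ln_mult)
  qed (simp add: hlog_def)
qed

text \<open>
  The minimand of the variational formula. The constant \<open>- s\<close> makes its minimum equal to \<open>phi\<close>.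
\<close>

definition clip_potential :: "'i set \<Rightarrow> nat \<Rightarrow> ('i \<Rightarrow> real) \<Rightarrow> real \<Rightarrow> real" where
  "clip_potential I s d a = (\<Sum>i\<in>I. hlog (d i / a)) + real s * ln a - real s"

text \<open>
  The stationarity condition of \<open>clip_potential\<close> in \<open>a\<close>.
\<close>

definition water_level :: "'i set \<Rightarrow> nat \<Rightarrow> ('i \<Rightarrow> real) \<Rightarrow> real \<Rightarrow> bool" where
  "water_level I s d a \<longleftrightarrow> 0 < a \<and> (\<Sum>i\<in>I. min (d i) a) = real s * a"

text \<open>
  As a function of \<open>ln a\<close> the potential is convex, and its derivative
  \<open>s - (\<Sum>i\<in>I. min (d i / a) 1)\<close> vanishes at a water level.
\<close>

lemma water_level_minimizes:
  assumes a: "water_level I s d a" and b: "0 < b" and d: "\<And>i. i \<in> I \<Longrightarrow> 0 \<le> d i"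
  shows "clip_potential I s d a \<le> clip_potential I s d b"
proof -
  have pos: "0 < a" using a by (simp add: water_level_def)
  have "(\<Sum>i\<in>I. hlog (d i / a) + min (d i / a) 1 * ln (a / b)) \<le> (\<Sum>i\<in>I. hlog (d i / b))"
  proof (rule sum_mono)
    fix i assume "i \<in> I"
    then show "hlog (d i / a) + min (d i / a) 1 * ln (a / b) \<le> hlog (d i / b)"
      using hlog_log_convex[of "d i / a" "a / b"] pos b d by simp
  qed
  moreover have "(\<Sum>i\<in>I. min (d i / a) 1 * ln (a / b)) = real s * ln (a / b)"
  proof -
    have "min (d i / a) 1 = min (d i) a / a" for i using pos by (simp add: min_def field_simps)
    then have "(\<Sum>i\<in>I. min (d i / a) 1) = (\<Sum>i\<in>I. min (d i) a) / a"
      by (simp add: sum_divide_distrib)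
    then have "(\<Sum>i\<in>I. min (d i / a) 1) = real s" using a pos by (simp add: water_level_def)
    then show ?thesis by (simp flip: sum_distrib_right)
  qed
  ultimately show ?thesis
    using pos b by (simp add: clip_potential_def sum.distrib ln_div right_diff_distrib)
qed

lemma water_level_le_card_pos:
  assumes a: "water_level I s d a" and I: "finite I" and d: "\<And>i. i \<in> I \<Longrightarrow> 0 \<le> d i"
  shows "s \<le> card {i \<in> I. 0 < d i}"
proof -
  have pos: "0 < a" using a by (simp add: water_level_def)
  have "real s * a = (\<Sum>i\<in>I. min (d i) a)" using a by (simp add: water_level_def)
  also have "\<dots> \<le> (\<Sum>i\<in>I. if 0 < d i then a else 0)"
    using d pos by (intro sum_mono) (auto simp: min_def)
  also have "\<dots> = real (card {i \<in> I. 0 < d i}) * a"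
    using I by (simp add: sum.If_cases Int_def)
  finally show ?thesis using pos by simp
qed

text \<open>
  The entries up to \<open>\<iota>\<close> lie above the tail average \<open>a\<close> and the others below it, so clipping at \<open>a\<close>
  gives the sum \<open>\<iota> a + (s - \<iota>) a\<close>, and \<open>phi\<close> is the potential at \<open>a\<close>. If \<open>a = 0\<close>, only the first
  \<open>\<iota> < s\<close> entries can be positive.
\<close>

lemma phi_cases:
  assumes s: "0 < s" "s \<le> k"
    and nonneg: "\<And>l. 1 \<le> l \<Longrightarrow> l \<le> k \<Longrightarrow> 0 \<le> lam l"
    and mono: "\<And>i j. 1 \<le> i \<Longrightarrow> i \<le> j \<Longrightarrow> j \<le> k \<Longrightarrow> lam j \<le> lam i"
  shows "(\<exists>a. water_level {1..k} s lam a \<and> phi k s lam = ereal (clip_potential {1..k} s lam a))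
    \<or> phi k s lam = -\<infinity> \<and> card {l \<in> {1..k}. 0 < lam l} < s"
proof -
  define i where "i = iota k s lam"
  define a where "a = tail_avg k s lam i"
  have iota: "is_iota k s lam i"
    unfolding i_def iota_def by (rule theI') (rule ex1_is_iota[OF s nonneg mono])
  then have ilt: "i < s" and top: "i \<noteq> 0 \<Longrightarrow> a < lam i" and bot: "lam (i + 1) \<le> a"
    by (auto simp: is_iota_def a_def)
  have head: "a < lam l" if "l \<in> {1..i}" for l
    using that top mono[of l i] ilt s by force
  have tail: "lam l \<le> a" if "l \<in> {i+1..k}" for l
    using that bot mono[of "i + 1" l] by force
  have split: "{1..k} = {1..i} \<union> {i+1..k}" using ilt s by auto
  have sum_split: "(\<Sum>l=1..k. f l) = (\<Sum>l=1..i. f l) + (\<Sum>l=i+1..k. f l)" for f :: "nat \<Rightarrow> real"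
    unfolding split by (rule sum.union_disjoint) auto
  have tail_sum: "(\<Sum>l=i+1..k. lam l) = (real s - real i) * a"
    using ilt by (simp add: a_def tail_avg_def)
  have a0: "0 \<le> a"
    using ilt nonneg by (auto simp: a_def tail_avg_def intro!: divide_nonneg_pos sum_nonneg)
  have phi: "phi k s lam = (\<Sum>l=1..i. elog (lam l)) + ereal (real s - real i) * elog a"
    by (simp add: phi_def Let_def i_def a_def)
  have elog_head: "elog (lam l) = ereal (ln (lam l))" if "l \<in> {1..i}" for l
    using head[OF that] a0 by (simp add: elog_def)
  then have phi': "phi k s lam = ereal (\<Sum>l=1..i. ln (lam l)) + ereal (real s - real i) * elog a"
    unfolding phi by simp
  show ?thesis
  proof (cases "a = 0")
    case True
    have "phi k s lam = -\<infinity>" using True ilt by (simp add: phi' elog_def)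
    moreover have "{l \<in> {1..k}. 0 < lam l} \<subseteq> {1..i}"
      using tail True by (force simp: not_less_eq_eq)
    then have "card {l \<in> {1..k}. 0 < lam l} \<le> i"
      by (metis card_mono finite_atLeastAtMost card_atLeastAtMost diff_Suc_1)
    ultimately show ?thesis using ilt by simp
  next
    case False
    with a0 have pos: "0 < a" by simp
    have "(\<Sum>l=1..i. min (lam l) a) = (\<Sum>l=1..i. a)"
      using head by (intro sum.cong) (auto simp: min_def dest: leD)
    moreover have "(\<Sum>l=i+1..k. min (lam l) a) = (\<Sum>l=i+1..k. lam l)"
      using tail by (intro sum.cong) (auto simp: min_def)
    ultimately have "(\<Sum>l=1..k. min (lam l) a) = real i * a + (real s - real i) * a"
      unfolding sum_split tail_sum by simp
    then have "water_level {1..k} s lam a"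
      using pos by (simp add: water_level_def algebra_simps)
    moreover have "(\<Sum>l=1..k. hlog (lam l / a))
        = (\<Sum>l=1..i. 1 + ln (lam l) - ln a) + (\<Sum>l=i+1..k. lam l / a)"
    proof -
      have "hlog (lam l / a) = 1 + ln (lam l) - ln a" if "l \<in> {1..i}" for l
        using head[OF that] pos by (simp add: hlog_def ln_div)
      moreover have "hlog (lam l / a) = lam l / a" if "l \<in> {i+1..k}" for l
        using tail[OF that] pos by (simp add: hlog_def)
      ultimately show ?thesis unfolding sum_split by (intro arg_cong2[where f=plus] sum.cong) auto
    qed
    moreover have "(\<Sum>l=i+1..k. lam l / a) = real s - real i"
      using tail_sum pos by (simp flip: sum_divide_distrib)
    ultimately have "clip_potential {1..k} s lam a
        = (\<Sum>l=1..i. ln (lam l)) + (real s - real i) * ln a"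
      by (simp add: clip_potential_def sum.distrib sum_subtractf algebra_simps)
    then have "phi k s lam = ereal (clip_potential {1..k} s lam a)"
      using pos by (simp add: phi' elog_def)
    with \<open>water_level {1..k} s lam a\<close> show ?thesis by blast
  qed
qed

text \<open>
  Concavity of \<open>a \<mapsto> min t a\<close> on the half line, as monotonicity of \<open>min t a / a\<close>.
\<close>

lemma min_scaling:
  fixes t a b :: real
  assumes "0 \<le> t" "0 < a" "a < b"
  shows "a * min t b \<le> b * min t a"
    and "0 < t \<Longrightarrow> t < b \<Longrightarrow> a * min t b < b * min t a"
  using assms mult_strict_right_mono[of a b t] mult_left_mono[of t b a] mult_right_mono[of a b t]
    mult_strict_left_mono[of t b a]
  by (auto simp: min_def mult.commute)

text \<open>
  With more than \<open>s\<close> positive entries one of them lies strictly below the level, so the clipped sum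
  divided by \<open>b\<close> is strictly decreasing near \<open>a\<close> and the level is an isolated sign change.
\<close>

lemma water_level_strict:
  assumes a: "water_level I s d a" and I: "finite I" and d: "\<And>i. i \<in> I \<Longrightarrow> 0 \<le> d i"
    and card: "s < card {i \<in> I. 0 < d i}"
  shows "0 < b \<Longrightarrow> b < a \<Longrightarrow> real s * b < (\<Sum>i\<in>I. min (d i) b)"
    and "a < b \<Longrightarrow> (\<Sum>i\<in>I. min (d i) b) < real s * b"
proof -
  have pos: "0 < a" and sum: "(\<Sum>i\<in>I. min (d i) a) = real s * a"
    using a by (auto simp: water_level_def)
  have "\<exists>j\<in>I. 0 < d j \<and> d j < a"
  proof (rule ccontr)
    assume "\<not> ?thesis"
    then have "min (d i) a = (if 0 < d i then a else 0)" if "i \<in> I" for i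
      using d[OF that] that pos by (auto simp: min_def not_less)
    then have "(\<Sum>i\<in>I. min (d i) a) = (\<Sum>i\<in>I. if 0 < d i then a else 0)" by (rule sum.cong[OF refl])
    also have "\<dots> = real (card {i \<in> I. 0 < d i}) * a"
      using I by (simp add: sum.If_cases Int_def)
    finally show False using sum card pos by simp
  qed
  then obtain j where j: "j \<in> I" "0 < d j" "d j < a" by blast
  show "real s * b < (\<Sum>i\<in>I. min (d i) b)" if "0 < b" "b < a"
  proof -
    have "(\<Sum>i\<in>I. b * min (d i) a) < (\<Sum>i\<in>I. a * min (d i) b)"
      by (rule sum_strict_mono_strong[OF I j(1)]) (use j that d min_scaling[of _ b a] in auto)
    then have "b * (real s * a) < a * (\<Sum>i\<in>I. min (d i) b)"
      by (simp add: sum flip: sum_distrib_left)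
    then show ?thesis using pos by (simp add: mult.left_commute[of b] mult.commute[of b])
  qed
  show "(\<Sum>i\<in>I. min (d i) b) < real s * b" if "a < b"
  proof -
    have "(\<Sum>i\<in>I. a * min (d i) b) < (\<Sum>i\<in>I. b * min (d i) a)"
      by (rule sum_strict_mono_strong[OF I j(1)]) (use j that d pos min_scaling[of _ a b] in auto)
    then have "a * (\<Sum>i\<in>I. min (d i) b) < a * (real s * b)"
      by (simp add: sum algebra_simps flip: sum_distrib_left)
    then show ?thesis using pos by simp
  qed
qed

text \<open>
  Below all positive entries, clipping only counts them. This is the degenerate case in which the
  water level is not unique.
\<close>

lemma water_level_small:
  assumes I: "finite I" and d: "\<And>i. i \<in> I \<Longrightarrow> 0 < d i \<Longrightarrow> a \<le> d i" "\<And>i. i \<in> I \<Longrightarrow> 0 \<le> d i"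
    and a: "0 < a"
  shows "water_level I (card {i \<in> I. 0 < d i}) d a"
proof -
  have "min (d i) a = (if 0 < d i then a else 0)" if "i \<in> I" for i
    using d(1)[OF that] d(2)[OF that] a by (auto simp: min_def)
  then have "(\<Sum>i\<in>I. min (d i) a) = (\<Sum>i\<in>I. if 0 < d i then a else 0)" by (rule sum.cong[OF refl])
  then show ?thesis using I a by (simp add: water_level_def sum.If_cases Int_def)
qed

text \<open>
  All water levels give the same potential, since each minimizes it; so \<open>Gam\<close> can be evaluated at
  any water level, which need not be the tail average of its definition.
\<close>

lemma Gam_eigensystem:
  fixes X :: "real^'k^'k"
  assumes X: "eigensystem X q d" and d: "\<And>i. 0 \<le> d i" and s: "0 < s" "s \<le> CARD('k)"
  shows "water_level UNIV s d a \<Longrightarrow> Gam s X = ereal (clip_potential UNIV s d a)"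
    and "\<bar>Gam s X\<bar> \<noteq> \<infinity> \<longleftrightarrow> s \<le> card {i. 0 < d i}"
    and "s \<le> card {i. 0 < d i} \<Longrightarrow> \<exists>a. water_level UNIV s d a"
    and "Gam s X \<noteq> \<infinity>"
proof -
  let ?I = "{1..CARD('k)}" and ?e = "eigval X"
  note ev = eigval_eigensystem[OF X]
  have level: "water_level ?I s ?e a \<longleftrightarrow> water_level UNIV s d a" for a
    by (simp only: water_level_def ev(1)[of "\<lambda>t. min t a"])
  have pot: "clip_potential ?I s ?e a = clip_potential UNIV s d a" for a
    by (simp only: clip_potential_def ev(1)[of "\<lambda>t. hlog (t / a)"])
  have "real (card {l \<in> ?I. 0 < ?e l}) = real (card {i. 0 < d i})"
    using ev(1)[of "\<lambda>t. if 0 < t then 1 else 0"] by (simp add: sum.If_cases Int_def)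
  then have card: "card {l \<in> ?I. 0 < ?e l} = card {i. 0 < d i}" by linarith
  have nonneg: "0 \<le> ?e l" if "1 \<le> l" "l \<le> CARD('k)" for l
    using ev(3)[OF that] d by auto
  have cases: "(\<exists>a. water_level UNIV s d a \<and> Gam s X = ereal (clip_potential UNIV s d a))
      \<or> Gam s X = -\<infinity> \<and> card {i. 0 < d i} < s"
    using phi_cases[OF s, of ?e, OF nonneg ev(2)] by (simp only: level pot card Gam_def)
  have le_card: "s \<le> card {i. 0 < d i}" if "water_level UNIV s d a" for a
    using water_level_le_card_pos[OF that] d by simp
  show "Gam s X = ereal (clip_potential UNIV s d a)" if a: "water_level UNIV s d a"
  proof -
    obtain b where b: "water_level UNIV s d b" "Gam s X = ereal (clip_potential UNIV s d b)"
      using cases le_card[OF a] by auto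
    have "clip_potential UNIV s d b = clip_potential UNIV s d a"
      using water_level_minimizes[OF a] water_level_minimizes[OF b(1)] a b(1) d
      by (meson antisym water_level_def)
    then show ?thesis using b by simp
  qed
  show "\<bar>Gam s X\<bar> \<noteq> \<infinity> \<longleftrightarrow> s \<le> card {i. 0 < d i}" using cases le_card by auto
  show "\<exists>a. water_level UNIV s d a" if "s \<le> card {i. 0 < d i}" using cases that by auto
  show "Gam s X \<noteq> \<infinity>" using cases by auto
qed

section \<open>Taylor bounds for traces of functions of a matrix\<close>

text \<open>
  The weights \<open>(q i \<bullet> r j)\<^sup>2\<close> are doubly stochastic by Parseval, and averaging the \<open>e j\<close> in row \<open>i\<close>
  gives the form of \<open>Y\<close> at \<open>q i\<close>. Choosing \<open>c i\<close> as the derivative of \<open>f\<close> at \<open>d i\<close> turns the summands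
  into scalar Taylor remainders.
\<close>

lemma spectral_sum_expansion:
  fixes X Y :: "real^'k^'k"
  assumes X: "eigensystem X q d" and Y: "eigensystem Y r e"
  shows "(\<Sum>j\<in>UNIV. f (e j)) - (\<Sum>i\<in>UNIV. f (d i)) - (\<Sum>i\<in>UNIV. c i * (q i \<bullet> ((Y - X) *v q i)))
    = (\<Sum>i\<in>UNIV. \<Sum>j\<in>UNIV. (q i \<bullet> r j)\<^sup>2 * (f (e j) - f (d i) - c i * (e j - d i)))"
proof -
  have col: "(\<Sum>i\<in>UNIV. (q i \<bullet> r j)\<^sup>2) = 1" for j
    using eigensystem_parseval[OF X, of "r j" "r j"] Y by (simp add: power2_eq_square eigensystem_def)
  have row: "(\<Sum>j\<in>UNIV. (q i \<bullet> r j)\<^sup>2) = 1" for i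
    using eigensystem_parseval[OF Y, of "q i" "q i"] X
    by (simp add: power2_eq_square eigensystem_def inner_commute)
  have e: "(\<Sum>j\<in>UNIV. (q i \<bullet> r j)\<^sup>2 * e j) = q i \<bullet> (Y *v q i)" for i
    by (simp add: eigensystem_quadratic_form[OF Y] inner_commute mult.commute)
  have "(\<Sum>i\<in>UNIV. \<Sum>j\<in>UNIV. (q i \<bullet> r j)\<^sup>2 * (f (e j) - f (d i) - c i * (e j - d i)))
     = (\<Sum>i\<in>UNIV. \<Sum>j\<in>UNIV. (q i \<bullet> r j)\<^sup>2 * f (e j))
       - (\<Sum>i\<in>UNIV. (\<Sum>j\<in>UNIV. (q i \<bullet> r j)\<^sup>2) * f (d i))
       - (\<Sum>i\<in>UNIV. c i * ((\<Sum>j\<in>UNIV. (q i \<bullet> r j)\<^sup>2 * e j) - (\<Sum>j\<in>UNIV. (q i \<bullet> r j)\<^sup>2) * d i))"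
    by (simp add: algebra_simps sum_subtractf sum.distrib sum_distrib_left sum_distrib_right)
  also have "(\<Sum>i\<in>UNIV. \<Sum>j\<in>UNIV. (q i \<bullet> r j)\<^sup>2 * f (e j)) = (\<Sum>j\<in>UNIV. (\<Sum>i\<in>UNIV. (q i \<bullet> r j)\<^sup>2) * f (e j))"
    by (subst sum.swap) (simp add: sum_distrib_right)
  finally show ?thesis
    using eigensystem_eigenvalue(1)[OF X]
    by (simp add: col row e matrix_vector_mult_diff_rdistrib inner_diff_right)
qed

text \<open>
  The entry of \<open>Y - X\<close> between \<open>q i\<close> and \<open>r j\<close> is \<open>(e j - d i) (q i \<bullet> r j)\<close>.
\<close>

lemma spectral_distance:
  fixes X Y :: "real^'k^'k"
  assumes X: "eigensystem X q d" and Y: "eigensystem Y r e"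
  shows "(\<Sum>i\<in>UNIV. \<Sum>j\<in>UNIV. (q i \<bullet> r j)\<^sup>2 * (e j - d i)\<^sup>2) = (\<Sum>j\<in>UNIV. (norm ((Y - X) *v r j))\<^sup>2)"
proof -
  have "(q i \<bullet> r j)\<^sup>2 * (e j - d i)\<^sup>2 = (q i \<bullet> ((Y - X) *v r j)) * (q i \<bullet> ((Y - X) *v r j))" for i j
    using Y by (simp add: matrix_vector_mult_diff_rdistrib inner_diff_right eigensystem_inner[OF X]
        eigensystem_def power2_eq_square algebra_simps)
  then show ?thesis
    by (subst sum.swap) (simp add: eigensystem_parseval[OF X] power2_norm_eq_inner)
qed

text \<open>
  Averaging the scalar bounds \<open>hlog_le_tangent\<close> and \<open>hlog_ge_tangent\<close> over pairs of eigenvalues; the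
  linear term is the pairing of \<open>Y - X\<close> with the matrix that has eigenvectors \<open>q i\<close> and eigenvalues
  \<open>1 / max (d i) a\<close>.
\<close>

lemma clip_potential_taylor:
  fixes X Y :: "real^'k^'k"
  assumes X: "eigensystem X q d" and Y: "eigensystem Y r e" and a: "0 < a"
  shows "clip_potential UNIV s e a \<le> clip_potential UNIV s d a
    + (\<Sum>i\<in>UNIV. (q i \<bullet> ((Y - X) *v q i)) / max (d i) a)" (is ?upper)
   and "clip_potential UNIV s d a + (\<Sum>i\<in>UNIV. (q i \<bullet> ((Y - X) *v q i)) / max (d i) a)
      - (\<Sum>j\<in>UNIV. (norm ((Y - X) *v r j))\<^sup>2) / a\<^sup>2 \<le> clip_potential UNIV s e a" (is ?lower)
proof -
  let ?w = "\<lambda>i j. (q i \<bullet> r j)\<^sup>2"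
  let ?R = "\<lambda>i j. hlog (e j / a) - hlog (d i / a) - 1 / max (d i) a * (e j - d i)"
  have slope: "(e j / a - d i / a) / max (d i / a) 1 = 1 / max (d i) a * (e j - d i)" for i j
    using a by (simp add: max_def field_simps)
  have eq: "clip_potential UNIV s e a - clip_potential UNIV s d a
      - (\<Sum>i\<in>UNIV. (q i \<bullet> ((Y - X) *v q i)) / max (d i) a) = (\<Sum>i\<in>UNIV. \<Sum>j\<in>UNIV. ?w i j * ?R i j)"
    using spectral_sum_expansion[OF X Y, of "\<lambda>t. hlog (t / a)" "\<lambda>i. 1 / max (d i) a"]
    by (simp add: clip_potential_def)
  have "?R i j \<le> 0" for i j
    using hlog_le_tangent[of "e j / a" "d i / a"] slope[of j i] by simp
  then have "(\<Sum>i\<in>UNIV. \<Sum>j\<in>UNIV. ?w i j * ?R i j) \<le> 0"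
    by (intro sum_nonpos mult_nonneg_nonpos) auto
  then show ?upper using eq by simp
  have "- ((e j - d i)\<^sup>2 / a\<^sup>2) \<le> ?R i j" for i j
  proof -
    have "(e j / a - d i / a)\<^sup>2 = (e j - d i)\<^sup>2 / a\<^sup>2"
      by (simp add: diff_divide_distrib[symmetric] power_divide)
    then show ?thesis
      using hlog_ge_tangent[of "d i / a" "e j / a"] slope[of j i] by linarith
  qed
  then have "(\<Sum>i\<in>UNIV. \<Sum>j\<in>UNIV. ?w i j * - ((e j - d i)\<^sup>2 / a\<^sup>2)) \<le> (\<Sum>i\<in>UNIV. \<Sum>j\<in>UNIV. ?w i j * ?R i j)"
    by (intro sum_mono mult_left_mono) auto
  also have "(\<Sum>i\<in>UNIV. \<Sum>j\<in>UNIV. ?w i j * - ((e j - d i)\<^sup>2 / a\<^sup>2))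
      = - (\<Sum>j\<in>UNIV. (norm ((Y - X) *v r j))\<^sup>2) / a\<^sup>2"
    by (simp add: sum_negf flip: spectral_distance[OF X Y] sum_divide_distrib)
  finally show ?lower using eq by simp
qed

text \<open>
  Clipping is 1-Lipschitz, and \<open>\<bar>x\<bar> \<le> (\<eta> + x\<^sup>2 / \<eta>) / 2\<close> reduces the average of \<open>\<bar>e j - d i\<bar>\<close> to that
  of the squares.
\<close>

lemma clipped_trace_lipschitz:
  fixes X Y :: "real^'k^'k" and \<eta> :: real
  assumes X: "eigensystem X q d" and Y: "eigensystem Y r e" and eta: "0 < \<eta>"
    and near: "\<And>v. norm v = 1 \<Longrightarrow> norm ((Y - X) *v v) \<le> \<eta>"
  shows "\<bar>(\<Sum>j\<in>UNIV. min (e j) a) - (\<Sum>i\<in>UNIV. min (d i) a)\<bar> \<le> CARD('k) * \<eta>"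
proof -
  let ?w = "\<lambda>i j. (q i \<bullet> r j)\<^sup>2"
  have row: "(\<Sum>j\<in>UNIV. ?w i j) = 1" for i
    using eigensystem_parseval[OF Y, of "q i" "q i"] X
    by (simp add: power2_eq_square eigensystem_def inner_commute)
  have "(\<Sum>j\<in>UNIV. min (e j) a) - (\<Sum>i\<in>UNIV. min (d i) a)
      = (\<Sum>i\<in>UNIV. \<Sum>j\<in>UNIV. ?w i j * (min (e j) a - min (d i) a))"
    using spectral_sum_expansion[OF X Y, of "\<lambda>t. min t a" "\<lambda>_. 0"] by simp
  also have "\<bar>\<dots>\<bar> \<le> (\<Sum>i\<in>UNIV. \<Sum>j\<in>UNIV. ?w i j * ((\<eta> + (e j - d i)\<^sup>2 / \<eta>) / 2))"
  proof (intro order.trans[OF sum_abs] sum_mono)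
    fix i j
    have "0 \<le> (\<bar>e j - d i\<bar> - \<eta>)\<^sup>2 / \<eta>" using eta by simp
    then have "\<bar>e j - d i\<bar> \<le> (\<eta> + (e j - d i)\<^sup>2 / \<eta>) / 2"
      using eta by (simp add: power2_diff power2_abs field_simps) (simp add: power2_eq_square)
    moreover have "\<bar>min (e j) a - min (d i) a\<bar> \<le> \<bar>e j - d i\<bar>" by linarith
    ultimately show "\<bar>?w i j * (min (e j) a - min (d i) a)\<bar> \<le> ?w i j * ((\<eta> + (e j - d i)\<^sup>2 / \<eta>) / 2)"
      unfolding abs_mult abs_power2 by (intro mult_left_mono) auto
  qed
  also have "\<dots> = ((\<Sum>i\<in>UNIV. (\<Sum>j\<in>UNIV. ?w i j) * \<eta>) + (\<Sum>i\<in>UNIV. \<Sum>j\<in>UNIV. ?w i j * (e j - d i)\<^sup>2) / \<eta>) / 2"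
    by (simp add: sum_distrib_left sum_distrib_right sum_divide_distrib add_divide_distrib
        distrib_left sum.distrib)
  also have "\<dots> = (CARD('k) * \<eta> + (\<Sum>j\<in>UNIV. (norm ((Y - X) *v r j))\<^sup>2) / \<eta>) / 2"
    by (simp only: row spectral_distance[OF X Y]) simp
  also have "\<dots> \<le> (CARD('k) * \<eta> + (CARD('k) * \<eta>\<^sup>2) / \<eta>) / 2"
  proof -
    have "(\<Sum>j\<in>UNIV. (norm ((Y - X) *v r j))\<^sup>2) \<le> (\<Sum>j\<in>(UNIV :: 'k set). \<eta>\<^sup>2)"
      using near eigensystem_eigenvalue(2)[OF Y] by (intro sum_mono power_mono) auto
    then show ?thesis using eta by (auto intro!: divide_right_mono)
  qed
  also have "\<dots> = CARD('k) * \<eta>" using eta by (simp add: power2_eq_square)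
  finally show ?thesis .
qed

text \<open>
  The sign change at \<open>a\<close> survives a small perturbation of the clipped trace, and the intermediate
  value theorem finds a level of \<open>Y\<close> near \<open>a\<close>.
\<close>

lemma water_level_stable:
  fixes X :: "real^'k^'k"
  assumes X: "eigensystem X q d" and d: "\<And>i. 0 \<le> d i" and a: "water_level UNIV s d a"
    and card: "s < card {i. 0 < d i}" and eps: "0 < \<epsilon>"
  obtains \<eta> :: real where "0 < \<eta>"
    "\<And>Y r e. eigensystem Y r e \<Longrightarrow> (\<And>v. norm v = 1 \<Longrightarrow> norm ((Y - X) *v v) \<le> \<eta>) \<Longrightarrow>
      \<exists>b. \<bar>b - a\<bar> < \<epsilon> \<and> water_level UNIV s e b"
proof -
  have pos: "0 < a" using a by (simp add: water_level_def)
  define \<delta> where "\<delta> = min \<epsilon> a / 2"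
  have delta: "0 < \<delta>" "\<delta> < \<epsilon>" "0 < a - \<delta>" using eps pos by (auto simp: \<delta>_def min_def)
  define T where "T = (\<lambda>d b. (\<Sum>i\<in>(UNIV :: 'k set). min (d i) b) - real s * b)"
  have lo: "0 < T d (a - \<delta>)" and hi: "T d (a + \<delta>) < 0"
    using water_level_strict[OF a _ _ ] d card delta by (auto simp: T_def)
  define \<eta> where "\<eta> = min (T d (a - \<delta>)) (- T d (a + \<delta>)) / CARD('k)"
  have eta: "0 < \<eta>" using lo hi by (simp add: \<eta>_def)
  have bound: "CARD('k) * \<eta> \<le> T d (a - \<delta>)" "CARD('k) * \<eta> \<le> - T d (a + \<delta>)" by (simp_all add: \<eta>_def)
  show ?thesis
  proof (rule that[OF eta])
    fix Y r e assume Y: "eigensystem Y r e" and near: "\<And>v. norm v = 1 \<Longrightarrow> norm ((Y - X) *v v) \<le> \<eta>"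
    have "\<bar>T e b - T d b\<bar> \<le> CARD('k) * \<eta>" for b
      using clipped_trace_lipschitz[OF X Y eta near, of b] by (simp add: T_def)
    from this[of "a - \<delta>"] this[of "a + \<delta>"] have "T e (a + \<delta>) \<le> 0" "0 \<le> T e (a - \<delta>)"
      using bound by linarith+
    moreover have "continuous_on {a - \<delta>..a + \<delta>} (T e)"
      unfolding T_def by (intro continuous_intros)
    ultimately obtain b where "a - \<delta> \<le> b" "b \<le> a + \<delta>" "T e b = 0"
      using IVT2'[of "T e" "a + \<delta>" 0 "a - \<delta>"] delta by auto
    then show "\<exists>b. \<bar>b - a\<bar> < \<epsilon> \<and> water_level UNIV s e b"
      using delta by (intro exI[of _ b]) (auto simp: water_level_def T_def)
  qed
qed

text \<open>
  Eigenvectors of \<open>Y\<close> for positive eigenvalues are orthogonal to the common kernel, so there the form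
  of \<open>X\<close> is at least \<open>c\<close> on unit vectors and that of \<open>Y\<close> at least \<open>c / 2\<close>. Hence no positive
  eigenvalue of \<open>Y\<close> is less than \<open>c / 2\<close>, and equal kernels
  make their number the same as for \<open>X\<close>.
\<close>

lemma water_level_same_kernel:
  fixes X Y :: "real^'k^'k"
  assumes X: "eigensystem X q d" and Y: "eigensystem Y r e"
    and d: "\<And>i. 0 \<le> d i" and e: "\<And>i. 0 \<le> e i"
    and ker: "\<And>v. X *v v = 0 \<longleftrightarrow> Y *v v = 0"
    and half: "\<And>v. v \<bullet> (X *v v) / 2 \<le> v \<bullet> (Y *v v)"
    and c: "0 < c" "\<And>i. 0 < d i \<Longrightarrow> c \<le> d i"
  shows "water_level UNIV (card {i. 0 < d i}) e (c / 2)"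
proof -
  have pos: "{i. d i \<noteq> 0} = {i. 0 < d i}" "{i. e i \<noteq> 0} = {i. 0 < e i}"
    using d e by (auto simp: less_le) 
  have "card {i. 0 < d i} = card {i. 0 < e i}"
    using nonzero_eigenvalues_le_rank[OF X] rank_le_nonzero_eigenvalues[OF X, of Y]
      nonzero_eigenvalues_le_rank[OF Y] rank_le_nonzero_eigenvalues[OF Y, of X] ker
    unfolding pos by (meson antisym order_trans)
  moreover have "c / 2 \<le> e j" if "0 < e j" for j
  proof -
    have orth: "q i \<bullet> r j = 0" if "d i = 0" for i
    proof -
      have "Y *v q i = 0" using ker[of "q i"] X that by (simp add: eigensystem_def)
      then have "e j * (q i \<bullet> r j) = 0"
        using eigensystem_inner[OF Y, of j "q i"] by (simp add: inner_commute)
      then show ?thesis using \<open>0 < e j\<close> by simp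
    qed
    have "c = c * (r j \<bullet> r j)" using Y by (simp add: eigensystem_def)
    also have "\<dots> = (\<Sum>i\<in>UNIV. c * (q i \<bullet> r j)\<^sup>2)"
      unfolding eigensystem_parseval[OF X, of "r j" "r j", symmetric]
      by (simp add: power2_eq_square sum_distrib_left)
    also have "\<dots> \<le> (\<Sum>i\<in>UNIV. d i * (q i \<bullet> r j)\<^sup>2)"
    proof (rule sum_mono)
      fix i show "c * (q i \<bullet> r j)\<^sup>2 \<le> d i * (q i \<bullet> r j)\<^sup>2"
        using orth[of i] c(2)[of i] d[of i] by (cases "d i = 0") (auto intro: mult_right_mono)
    qed
    also have "\<dots> = r j \<bullet> (X *v r j)" by (simp add: eigensystem_quadratic_form[OF X])
    finally show ?thesis using half[of "r j"] eigensystem_eigenvalue(1)[OF Y, of j] by simp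
  qed
  ultimately show ?thesis
    using water_level_small[of UNIV e "c / 2"] e c by simp
qed

section \<open>Differentiability on weights of equal support\<close>

lemma F_DDFact_mult:
  fixes F :: "real^'k^'n"
  shows "F_DDFact F x U *v v = (\<Sum>i\<in>UNIV. (U $ i * x $ i * (row i F \<bullet> v)) *\<^sub>R row i F)"
proof -
  have rank1: "(columnvector f :: real^1^'k) ** (rowvector f :: real^'k^1) *v v = (f \<bullet> v) *\<^sub>R f"
    for f :: "real^'k"
    by (simp add: vec_eq_iff matrix_vector_mult_def matrix_matrix_mult_def columnvector_def
        rowvector_def inner_vec_def sum_distrib_left mult_ac)
  have "F_DDFact F x U *v v = (\<Sum>i\<in>UNIV. (U $ i * x $ i) *\<^sub>R
     ((columnvector (row i F) :: real^1^'k) ** (rowvector (row i F) :: real^'k^1) *v v))"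
    unfolding F_DDFact_def
    by (subst linear_sum[where f="\<lambda>M. M *v v", OF linearI])
       (auto simp: matrix_vector_mult_add_rdistrib scaleR_matrix_vector_assoc)
  then show ?thesis by (simp add: rank1)
qed

abbreviation row_gram :: "real^'k^'n \<Rightarrow> real^'n \<Rightarrow> real^'k^'k" where
  "row_gram F w \<equiv> F_DDFact F w 1"

lemma F_DDFact_row_gram: "F_DDFact F x U = row_gram F (\<chi> i. U $ i * x $ i)"
  by (simp add: F_DDFact_def)

lemma row_gram_diff: "row_gram F w - row_gram F w' = row_gram F (w - w')"
  by (simp add: F_DDFact_def scaleR_left_diff_distrib sum_subtractf)

lemma transpose_row_gram: "transpose (row_gram F w) = row_gram F w"
  by (simp add: F_DDFact_def transpose_def vec_eq_iff matrix_matrix_mult_def columnvector_def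
        rowvector_def mult_ac)

lemma row_gram_form: "v \<bullet> (row_gram F w *v v) = (\<Sum>i\<in>UNIV. w $ i * (row i F \<bullet> v)\<^sup>2)"
  by (simp add: F_DDFact_mult inner_sum_right inner_commute power2_eq_square mult_ac)

lemma row_gram_kernel:
  assumes w: "\<And>i. 0 \<le> w $ i"
  shows "row_gram F w *v v = 0 \<longleftrightarrow> (\<forall>i. w $ i \<noteq> 0 \<longrightarrow> row i F \<bullet> v = 0)"
proof
  assume "row_gram F w *v v = 0"
  then have "(\<Sum>i\<in>UNIV. w $ i * (row i F \<bullet> v)\<^sup>2) = 0" using row_gram_form[of v F w] by simp
  then have "\<forall>i\<in>UNIV. w $ i * (row i F \<bullet> v)\<^sup>2 = 0"
    by (subst (asm) sum_nonneg_eq_0_iff) (simp_all add: w)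
  then show "\<forall>i. w $ i \<noteq> 0 \<longrightarrow> row i F \<bullet> v = 0" by auto
next
  assume "\<forall>i. w $ i \<noteq> 0 \<longrightarrow> row i F \<bullet> v = 0"
  then show "row_gram F w *v v = 0" by (auto simp: F_DDFact_mult intro!: sum.neutral)
qed

lemma norm_row_gram_le:
  "norm (row_gram F h *v v) \<le> (\<Sum>i\<in>UNIV. (norm (row i F))\<^sup>2) * norm h * norm v"
proof -
  have "norm (row_gram F h *v v) \<le> (\<Sum>i\<in>UNIV. \<bar>h $ i\<bar> * \<bar>row i F \<bullet> v\<bar> * norm (row i F))"
    unfolding F_DDFact_mult by (rule order.trans[OF norm_sum]) (simp add: abs_mult)
  also have "\<dots> \<le> (\<Sum>i\<in>UNIV. norm h * (norm (row i F) * norm v) * norm (row i F))"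
    by (intro sum_mono mult_right_mono mult_mono component_le_norm_cart Cauchy_Schwarz_ineq2) auto
  finally show ?thesis by (simp add: sum_distrib_left sum_distrib_right power2_eq_square mult_ac)
qed

lemma row_gram_eigensystem:
  assumes w: "\<And>i. 0 \<le> w $ i"
  obtains q d where "eigensystem (row_gram F w) q d" "\<And>i. 0 \<le> d i"
proof -
  obtain q d where X: "eigensystem (row_gram F w) q d"
    using symmetric_eigensystem[OF transpose_row_gram] by blast
  have "0 \<le> d i" for i
    using w by (auto simp: eigensystem_eigenvalue(1)[OF X] row_gram_form intro!: sum_nonneg)
  with X show ?thesis by (rule that)
qed

text \<open>
  On this set of weights the kernel of the Gram matrix is constant. Entries above 1 are admitted, so that
  the set contains scaled points and both directions of an exchange.
\<close>

definition same_support :: "real^'n \<Rightarrow> (real^'n) set" where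
  "same_support w = {w'. \<forall>i. 0 \<le> w' $ i \<and> (w' $ i = 0 \<longleftrightarrow> w $ i = 0)}"

lemma Gam_finite_same_support:
  fixes F :: "real^'k^'n"
  assumes s: "0 < s" "s \<le> CARD('k)" and w: "w \<in> same_support w" and w': "w' \<in> same_support w"
    and fin: "\<bar>Gam s (row_gram F w)\<bar> \<noteq> \<infinity>"
  shows "\<bar>Gam s (row_gram F w')\<bar> \<noteq> \<infinity>"
proof -
  have nonneg: "0 \<le> w $ i" "0 \<le> w' $ i" for i using w w' by (auto simp: same_support_def)
  obtain q d where X: "eigensystem (row_gram F w) q d" and d: "\<And>i. 0 \<le> d i"
    using row_gram_eigensystem[of w F] nonneg by blast
  obtain r e where Y: "eigensystem (row_gram F w') r e" and e: "\<And>i. 0 \<le> e i"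
    using row_gram_eigensystem[of w' F] nonneg by blast
  have pos: "{i. d i \<noteq> 0} = {i. 0 < d i}" "{i. e i \<noteq> 0} = {i. 0 < e i}"
    using d e by (auto simp: less_le)
  have "row_gram F w' *v v = 0 \<Longrightarrow> row_gram F w *v v = 0" for v
    using w' by (auto simp: row_gram_kernel nonneg same_support_def)
  then have "rank (row_gram F w) \<le> card {i. 0 < e i}"
    using rank_le_nonzero_eigenvalues[OF Y] pos by metis
  with nonzero_eigenvalues_le_rank[OF X] have "card {i. 0 < d i} \<le> card {i. 0 < e i}"
    unfolding pos by linarith
  then show ?thesis
    using fin Gam_eigensystem(2)[OF X d s] Gam_eigensystem(2)[OF Y e s] by simp
qed

text \<open>
  Levels of nearby matrices can be chosen close to one fixed level of \<open>X\<close>. When \<open>X\<close> has exactly \<open>s\<close>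
  positive eigenvalues that fixed level must be chosen below the smallest of them, and then it serves
  all nearby weights of the same support at once.
\<close>

lemma row_gram_water_level_near:
  fixes F :: "real^'k^'n"
  assumes s: "0 < s" "s \<le> CARD('k)" and w: "w \<in> same_support w"
    and fin: "\<bar>Gam s (row_gram F w)\<bar> \<noteq> \<infinity>"
    and X: "eigensystem (row_gram F w) q d"
  obtains a where "water_level UNIV s d a"
    "\<And>\<epsilon>. 0 < \<epsilon> \<Longrightarrow> \<exists>\<delta>>0. \<forall>w'\<in>same_support w. norm (w' - w) < \<delta> \<longrightarrow>
      (\<forall>r e. eigensystem (row_gram F w') r e \<longrightarrow> (\<exists>b. \<bar>b - a\<bar> < \<epsilon> \<and> water_level UNIV s e b))"
proof -
  have nonneg: "0 \<le> w $ i" for i using w by (auto simp: same_support_def)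
  have d: "0 \<le> d i" for i
    using nonneg by (auto simp: eigensystem_eigenvalue(1)[OF X] row_gram_form intro!: sum_nonneg)
  have card: "s \<le> card {i. 0 < d i}" using fin Gam_eigensystem(2)[OF X d s] by simp
  show ?thesis
  proof (cases "s = card {i. 0 < d i}")
    case False
    obtain a where a: "water_level UNIV s d a" using Gam_eigensystem(3)[OF X d s card] by blast
    have "\<exists>\<delta>>0. \<forall>w'\<in>same_support w. norm (w' - w) < \<delta> \<longrightarrow>
      (\<forall>r e. eigensystem (row_gram F w') r e \<longrightarrow> (\<exists>b. \<bar>b - a\<bar> < \<epsilon> \<and> water_level UNIV s e b))"
      if eps: "0 < \<epsilon>" for \<epsilon>
    proof -
      obtain \<eta> where eta: "0 < \<eta>" and near: "\<And>Y r e. eigensystem Y r e \<Longrightarrow>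
        (\<And>v. norm v = 1 \<Longrightarrow> norm ((Y - row_gram F w) *v v) \<le> \<eta>) \<Longrightarrow>
        \<exists>b. \<bar>b - a\<bar> < \<epsilon> \<and> water_level UNIV s e b"
        using water_level_stable[OF X d a _ eps] card False by auto
      define K where "K = (\<Sum>i\<in>UNIV. (norm (row i F))\<^sup>2)"
      have K: "0 \<le> K" by (simp add: K_def sum_nonneg)
      have "norm ((row_gram F w' - row_gram F w) *v v) \<le> \<eta>"
        if "norm (w' - w) < \<eta> / (K + 1)" "norm v = 1" for w' and v
      proof -
        have "norm ((row_gram F w' - row_gram F w) *v v) \<le> K * norm (w' - w)"
          using norm_row_gram_le[of F "w' - w" v] that by (simp add: row_gram_diff K_def)
        also have "\<dots> \<le> (K + 1) * norm (w' - w)" by (simp add: distrib_right)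
        also have "\<dots> \<le> \<eta>" using that K by (simp add: field_simps)
        finally show ?thesis .
      qed
      then show ?thesis
        using near eta K by (intro exI[of _ "\<eta> / (K + 1)"]) auto
    qed
    with a show ?thesis by (rule that)
  next
    case True
    then have ne: "{i. 0 < d i} \<noteq> {}" using s by (metis card.empty less_irrefl)
    define c where "c = Min (d ` {i. 0 < d i})"
    have c: "0 < c" "\<And>i. 0 < d i \<Longrightarrow> c \<le> d i"
      using ne by (auto simp: c_def)
    \<comment> \<open>Within distance \<open>m\<close> the weights at least halve, which bounds the form of \<open>w'\<close> below by half that of \<open>w\<close>.\<close>
    define m where "m = Min (insert 1 ((\<lambda>i. w $ i / 2) ` {i. w $ i \<noteq> 0}))"
    have "0 < w $ i" if "w $ i \<noteq> 0" for i using nonneg[of i] that by linarith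
    then have m: "0 < m" "\<And>i. w $ i \<noteq> 0 \<Longrightarrow> m \<le> w $ i / 2"
      by (simp add: m_def, unfold m_def, intro Min_le, auto)
    have level: "water_level UNIV s e (c / 2)"
      if w': "w' \<in> same_support w" "norm (w' - w) < m" and Y: "eigensystem (row_gram F w') r e"
      for w' r e
    proof -
      have nonneg': "0 \<le> w' $ i" for i using w' by (auto simp: same_support_def)
      have e: "0 \<le> e i" for i
        using nonneg' by (auto simp: eigensystem_eigenvalue(1)[OF Y] row_gram_form intro!: sum_nonneg)
      have ker: "row_gram F w *v v = 0 \<longleftrightarrow> row_gram F w' *v v = 0" for v
        using w' by (simp add: row_gram_kernel nonneg nonneg' same_support_def)
      have half: "w $ i / 2 \<le> w' $ i" for i
      proof (cases "w $ i = 0")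
        case False
        have "\<bar>(w' - w) $ i\<bar> < m" using component_le_norm_cart[of "w' - w" i] w'(2) by linarith
        then have "w $ i - m \<le> w' $ i" by simp
        then show ?thesis using m(2)[OF False] by linarith
      qed (simp add: nonneg')
      have "v \<bullet> (row_gram F w *v v) / 2 \<le> v \<bullet> (row_gram F w' *v v)" for v
        unfolding row_gram_form sum_divide_distrib times_divide_eq_left[symmetric]
        by (intro sum_mono mult_right_mono half) auto
      from water_level_same_kernel[OF X Y d e ker this c] show ?thesis by (simp add: True)
    qed
    have "water_level UNIV s d (c / 2)" using level[OF w _ X] m(1) by simp
    moreover have "\<exists>\<delta>>0. \<forall>w'\<in>same_support w. norm (w' - w) < \<delta> \<longrightarrow>
      (\<forall>r e. eigensystem (row_gram F w') r e \<longrightarrow> (\<exists>b. \<bar>b - c / 2\<bar> < \<epsilon> \<and> water_level UNIV s e b))"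
      if eps: "0 < \<epsilon>" for \<epsilon>
      using m(1) level eps by (intro exI[of _ m]) (metis abs_zero diff_self)
    ultimately show ?thesis by (rule that)
  qed
qed

text \<open>
  The numbers \<open>f \<bullet> \<Theta> f\<close>, for the rows \<open>f\<close> of \<open>F\<close> and the gradient \<open>\<Theta>\<close> of \<open>\<Gamma>\<close>. For
  \<open>a\<close> at most every positive eigenvalue they are, up to the weights, the statistical leverage scores of
  the rows in the support.
\<close>

definition leverage :: "real^'k^'n \<Rightarrow> ('k \<Rightarrow> real^'k) \<Rightarrow> ('k \<Rightarrow> real) \<Rightarrow> real \<Rightarrow> real^'n" where
  "leverage F q d a = (\<chi> j. \<Sum>i\<in>UNIV. (row j F \<bullet> q i)\<^sup>2 / max (d i) a)"

lemma leverage_form: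
  "(\<Sum>i\<in>UNIV. (q i \<bullet> (row_gram F h *v q i)) / max (d i) a) = h \<bullet> leverage F q d a"
proof -
  have "(\<Sum>i\<in>UNIV. (q i \<bullet> (row_gram F h *v q i)) / max (d i) a)
      = (\<Sum>i\<in>UNIV. \<Sum>j\<in>UNIV. h $ j * ((row j F \<bullet> q i)\<^sup>2 / max (d i) a))"
    by (simp add: row_gram_form sum_divide_distrib)
  also have "\<dots> = h \<bullet> leverage F q d a"
    by (subst sum.swap) (simp add: inner_vec_def leverage_def sum_distrib_left)
  finally show ?thesis .
qed

text \<open>
  An envelope argument. The level \<open>a\<close> of \<open>w\<close> gives the upper bound, by concavity of the potential in
  the matrix. For the lower bound the level \<open>b\<close> of \<open>w'\<close> is used: the potential of \<open>w\<close> at \<open>b\<close> is at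
  least its minimum, the Taylor error is quadratic, and the slope at \<open>b\<close> differs little from that
  at \<open>a\<close> because \<open>b\<close> is close to \<open>a\<close>.
\<close>

lemma Gam_has_derivative_same_support:
  fixes F :: "real^'k^'n"
  assumes s: "0 < s" "s \<le> CARD('k)" and w: "w \<in> same_support w"
    and fin: "\<bar>Gam s (row_gram F w)\<bar> \<noteq> \<infinity>"
    and X: "eigensystem (row_gram F w) q d"
  obtains a where "water_level UNIV s d a"
    "((\<lambda>w. real_of_ereal (Gam s (row_gram F w))) has_derivative (\<lambda>h. h \<bullet> leverage F q d a))
      (at w within same_support w)"
proof -
  obtain a where a: "water_level UNIV s d a" and
    near: "\<And>\<epsilon>. 0 < \<epsilon> \<Longrightarrow> \<exists>\<delta>>0. \<forall>w'\<in>same_support w. norm (w' - w) < \<delta> \<longrightarrow>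
      (\<forall>r e. eigensystem (row_gram F w') r e \<longrightarrow> (\<exists>b. \<bar>b - a\<bar> < \<epsilon> \<and> water_level UNIV s e b))"
    using row_gram_water_level_near[OF s w fin X] by blast
  have pos: "0 < a" using a by (simp add: water_level_def)
  have d: "0 \<le> d i" for i
    using w by (auto simp: eigensystem_eigenvalue(1)[OF X] row_gram_form same_support_def intro!: sum_nonneg)
  let ?G = "\<lambda>w. real_of_ereal (Gam s (row_gram F w))"
  define K where "K = (\<Sum>i\<in>UNIV. (norm (row i F))\<^sup>2)"
  have K: "0 \<le> K" by (simp add: K_def sum_nonneg)
  define N where "N = real CARD('k)"
  have N: "0 < N" by (simp add: N_def)
  have "\<exists>\<delta>>0. \<forall>w'\<in>same_support w. norm (w' - w) < \<delta> \<longrightarrow>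
      norm (?G w' - ?G w - (w' - w) \<bullet> leverage F q d a) \<le> \<epsilon> * norm (w' - w)"
    if eps: "0 < \<epsilon>" for \<epsilon>
  proof -
    \<comment> \<open>Half of \<open>\<epsilon>\<close> is spent on the change of slope, controlled by \<open>t\<close>, and half on the quadratic error, controlled by \<open>\<delta>'\<close>; \<open>t \<le> a / 2\<close> keeps the levels away from 0.\<close>
    define t where "t = min (a / 2) (\<epsilon> * a\<^sup>2 / (4 * (N * K + 1)))"
    have NK: "0 \<le> N * K" using N K by simp
    have t: "0 < t" using eps pos NK by (simp add: t_def)
    obtain \<delta> where delta: "0 < \<delta>" and lev: "\<And>w' r e. w' \<in> same_support w \<Longrightarrow> norm (w' - w) < \<delta> \<Longrightarrow>
      eigensystem (row_gram F w') r e \<Longrightarrow> \<exists>b. \<bar>b - a\<bar> < t \<and> water_level UNIV s e b"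
      using near[OF t] by blast
    define \<delta>' where "\<delta>' = min \<delta> (\<epsilon> * a\<^sup>2 / (8 * (N * K\<^sup>2 + 1)))"
    have NK2: "0 \<le> N * K\<^sup>2" using N by simp
    have delta': "0 < \<delta>'" using delta eps pos NK2 by (simp add: \<delta>'_def)
    have "norm (?G w' - ?G w - (w' - w) \<bullet> leverage F q d a) \<le> \<epsilon> * norm (w' - w)"
      if w': "w' \<in> same_support w" and h: "norm (w' - w) < \<delta>'" for w'
    proof -
      let ?h = "norm (w' - w)"
      obtain r e where Y: "eigensystem (row_gram F w') r e" and e: "\<And>i. 0 \<le> e i"
        using row_gram_eigensystem[of w' F] w' by (auto simp: same_support_def)
      obtain b where bt: "\<bar>b - a\<bar> < t" and b: "water_level UNIV s e b"
        using lev[OF w' _ Y] h by (auto simp: \<delta>'_def)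
      have b2: "a / 2 \<le> b" "0 < b" using bt pos unfolding t_def by linarith+
      have G: "?G w = clip_potential UNIV s d a" "?G w' = clip_potential UNIV s e b"
        using Gam_eigensystem(1)[OF X d s a] Gam_eigensystem(1)[OF Y e s b] by simp_all
      have shift: "norm (row_gram F (w' - w) *v v) \<le> K * ?h" if "norm v = 1" for v
        using norm_row_gram_le[of F "w' - w" v] that by (simp add: K_def)
      note nq = eigensystem_eigenvalue(2)[OF X] and nr = eigensystem_eigenvalue(2)[OF Y]
      have upper: "?G w' - ?G w \<le> (w' - w) \<bullet> leverage F q d a"
        using water_level_minimizes[OF b pos] e clip_potential_taylor(1)[OF X Y pos, of s]
        by (fastforce simp: G row_gram_diff leverage_form)
      have "clip_potential UNIV s d a \<le> clip_potential UNIV s d b"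
        using water_level_minimizes[OF a b2(2)] d by simp
      then have lower: "(w' - w) \<bullet> leverage F q d b - (\<Sum>j\<in>UNIV. (norm (row_gram F (w' - w) *v r j))\<^sup>2) / b\<^sup>2
          \<le> ?G w' - ?G w"
        using clip_potential_taylor(2)[OF X Y b2(2), of s]
        by (simp add: G row_gram_diff leverage_form)
      have quad: "(\<Sum>j\<in>UNIV. (norm (row_gram F (w' - w) *v r j))\<^sup>2) / b\<^sup>2 \<le> \<epsilon> / 2 * ?h"
      proof -
        have "(\<Sum>j\<in>UNIV. (norm (row_gram F (w' - w) *v r j))\<^sup>2) \<le> (\<Sum>j\<in>(UNIV :: 'k set). (K * ?h)\<^sup>2)"
          by (intro sum_mono power_mono shift nr) auto
        then have "(\<Sum>j\<in>UNIV. (norm (row_gram F (w' - w) *v r j))\<^sup>2) / b\<^sup>2 \<le> N * (K * ?h)\<^sup>2 / (a / 2)\<^sup>2"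
          using b2 pos by (intro frac_le) (auto simp: N_def)
        also have "\<dots> = 4 * (N * K\<^sup>2) * ?h / a\<^sup>2 * ?h" by (simp add: power2_eq_square)
        also have "\<dots> \<le> \<epsilon> / 2 * ?h"
        proof (rule mult_right_mono)
          have "4 * (N * K\<^sup>2) * ?h \<le> 4 * (N * K\<^sup>2 + 1) * (\<epsilon> * a\<^sup>2 / (8 * (N * K\<^sup>2 + 1)))"
            using h NK2 by (intro mult_mono) (auto simp: \<delta>'_def)
          also have "\<dots> = \<epsilon> / 2 * a\<^sup>2" using NK2 by (simp add: field_simps)
          finally show "4 * (N * K\<^sup>2) * ?h / a\<^sup>2 \<le> \<epsilon> / 2" using pos by (simp add: field_simps)
        qed simp
        finally show ?thesis .
      qed
      have lin: "\<bar>(w' - w) \<bullet> leverage F q d b - (w' - w) \<bullet> leverage F q d a\<bar> \<le> \<epsilon> / 2 * ?h"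
      proof -
        let ?p = "\<lambda>i. q i \<bullet> (row_gram F (w' - w) *v q i)"
        have p: "\<bar>?p i\<bar> \<le> K * ?h" for i
          using Cauchy_Schwarz_ineq2[of "q i" "row_gram F (w' - w) *v q i"] shift[OF nq[of i]] nq[of i]
          by simp
        have coeff: "\<bar>1 / max (d i) b - 1 / max (d i) a\<bar> \<le> 2 * t / a\<^sup>2" for i
        proof -
          have pm: "0 < max (d i) b" "0 < max (d i) a" using b2 pos by auto
          have "\<bar>1 / max (d i) b - 1 / max (d i) a\<bar> = \<bar>max (d i) a - max (d i) b\<bar> / (max (d i) b * max (d i) a)"
            using pm by (subst diff_frac_eq) (auto simp: abs_mult mult.commute)
          also have "\<dots> \<le> t / (a / 2 * a)"
            using bt b2 pos by (intro frac_le mult_mono) auto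
          finally show ?thesis using pos by (simp add: power2_eq_square field_simps)
        qed
        have "(w' - w) \<bullet> leverage F q d b - (w' - w) \<bullet> leverage F q d a
            = (\<Sum>i\<in>UNIV. (1 / max (d i) b - 1 / max (d i) a) * ?p i)"
          by (simp add: left_diff_distrib sum_subtractf flip: leverage_form)
        also have "\<bar>\<dots>\<bar> \<le> (\<Sum>i\<in>(UNIV :: 'k set). 2 * t / a\<^sup>2 * (K * ?h))"
        proof (intro order.trans[OF sum_abs] sum_mono)
          fix i
          show "\<bar>(1 / max (d i) b - 1 / max (d i) a) * ?p i\<bar> \<le> 2 * t / a\<^sup>2 * (K * ?h)"
            unfolding abs_mult using coeff p t by (intro mult_mono) auto
        qed
        also have "\<dots> = 2 * (N * K) * t / a\<^sup>2 * ?h" by (simp add: N_def)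
        also have "\<dots> \<le> \<epsilon> / 2 * ?h"
        proof (rule mult_right_mono)
          have "2 * (N * K) * t \<le> 2 * (N * K + 1) * (\<epsilon> * a\<^sup>2 / (4 * (N * K + 1)))"
            using NK t by (intro mult_mono) (auto simp: t_def)
          also have "\<dots> = \<epsilon> / 2 * a\<^sup>2" using NK by (simp add: field_simps)
          finally show "2 * (N * K) * t / a\<^sup>2 \<le> \<epsilon> / 2" using pos by (simp add: field_simps)
        qed simp
        finally show ?thesis .
      qed
      have "0 \<le> \<epsilon> * ?h" using eps by simp
      then show ?thesis using upper lower quad lin unfolding real_norm_def by linarith
    qed
    with delta' show ?thesis by blast
  qed
  then have "(?G has_derivative (\<lambda>h. h \<bullet> leverage F q d a)) (at w within same_support w)"
    unfolding has_derivative_within_alt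
    by (auto intro!: bounded_linear_inner_left_comp bounded_linear_ident)
  with a show ?thesis by (rule that)
qed

section \<open>The gradient with respect to the scaling and optimality\<close>

text \<open>
  The matrix depends on \<open>x\<close> and the scaling \<open>V\<close> only through the weights \<open>V i * x i\<close>, and on the open
  orthant these all have the support of \<open>x\<close>. The derivative in the weights is returned as well,
  for the variation of \<open>x\<close> at an optimum.
\<close>

lemma f_DDFact_gradient:
  fixes F :: "real^'k^'n" and U x :: "real^'n"
  defines "w \<equiv> \<chi> i. U $ i * x $ i"
  assumes s: "0 < s" "s \<le> CARD('k)" and x: "\<And>i. 0 \<le> x $ i" and U: "positive_vec U"
    and fin: "\<bar>Gam s (row_gram F w)\<bar> \<noteq> \<infinity>"
    and X: "eigensystem (row_gram F w) q d"
  obtains a where "water_level UNIV s d a"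
    "((\<lambda>w. real_of_ereal (Gam s (row_gram F w))) has_derivative (\<lambda>h. h \<bullet> leverage F q d a))
      (at w within same_support w)"
    "ereal_gradient_at (\<lambda>V. f_DDFact F s x V) U (\<chi> i. x $ i * (leverage F q d a $ i - 1 / U $ i))"
proof -
  define P :: "(real^'n) set" where "P = {V. positive_vec V}"
  have "P = (\<Inter>i. {V. 0 < V $ i})" by (auto simp: P_def positive_vec_def)
  then have "open P" by (simp add: open_INT open_Collect_less continuous_intros)
  have UP: "U \<in> P" using U by (simp add: P_def)
  define sc where "sc = (\<lambda>V. (\<chi> i. V $ i * x $ i) :: real^'n)"
  have w: "w = sc U" by (simp add: w_def sc_def)
  have sc_support: "sc V \<in> same_support w" if "V \<in> P" for V
  proof -
    have "0 < V $ i" "0 < U $ i" for i using that UP by (auto simp: P_def positive_vec_def)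
    then show ?thesis
      using x by (auto simp: sc_def w_def same_support_def less_imp_le less_imp_neq[symmetric])
  qed
  then have ww: "w \<in> same_support w" using UP w by simp
  let ?G = "\<lambda>w. real_of_ereal (Gam s (row_gram F w))"
  obtain a where a: "water_level UNIV s d a" and
    der: "(?G has_derivative (\<lambda>h. h \<bullet> leverage F q d a)) (at w within same_support w)"
    using Gam_has_derivative_same_support[OF s ww fin X] by blast
  have finV: "\<bar>Gam s (row_gram F (sc V))\<bar> \<noteq> \<infinity>" if "V \<in> P" for V
    using Gam_finite_same_support[OF s ww sc_support[OF that] fin] .
  have f: "f_DDFact F s x V = Gam s (row_gram F (sc V)) - ereal (\<Sum>i\<in>UNIV. x $ i * ln (V $ i))" for V
    by (simp add: f_DDFact_def F_DDFact_row_gram[of F x V] sc_def)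
  have "linear sc" by (rule linearI) (auto simp: sc_def vec_eq_iff algebra_simps)
  then have "(sc has_derivative sc) (at U within P)"
    by (simp add: linear_imp_has_derivative)
  moreover have "(?G has_derivative (\<lambda>h. h \<bullet> leverage F q d a)) (at (sc U) within sc ` P)"
    using der sc_support w by (auto intro: has_derivative_subset)
  ultimately have "((\<lambda>V. ?G (sc V)) has_derivative (\<lambda>h. sc h \<bullet> leverage F q d a)) (at U within P)"
    by (rule has_derivative_in_compose)
  moreover have "((\<lambda>V. \<Sum>i\<in>UNIV. x $ i * ln (V $ i)) has_derivative
      (\<lambda>h. \<Sum>i\<in>UNIV. x $ i * (h $ i * (1 / U $ i)))) (at U within P)"
  proof (intro has_derivative_sum has_derivative_mult_right)
    fix i
    have "0 < U $ i" using U by (simp add: positive_vec_def)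
    then show "((\<lambda>V. ln (V $ i)) has_derivative (\<lambda>h. h $ i * (1 / U $ i))) (at U within P)"
      by (auto intro!: derivative_eq_intros bounded_linear.has_derivative[OF bounded_linear_vec_nth]
          simp: field_simps)
  qed
  ultimately have diff: "((\<lambda>V. ?G (sc V) - (\<Sum>i\<in>UNIV. x $ i * ln (V $ i))) has_derivative
      (\<lambda>h. sc h \<bullet> leverage F q d a - (\<Sum>i\<in>UNIV. x $ i * (h $ i * (1 / U $ i))))) (at U within P)"
    by (rule has_derivative_diff)
  have "sc h \<bullet> leverage F q d a - (\<Sum>i\<in>UNIV. x $ i * (h $ i * (1 / U $ i)))
      = h \<bullet> (\<chi> i. x $ i * (leverage F q d a $ i - 1 / U $ i))" for h
    unfolding inner_vec_def sc_def sum_subtractf[symmetric]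
    by (intro sum.cong) (simp_all add: right_diff_distrib mult_ac)
  then have der_diff: "((\<lambda>V. ?G (sc V) - (\<Sum>i\<in>UNIV. x $ i * ln (V $ i))) has_derivative
      (\<lambda>h. h \<bullet> (\<chi> i. x $ i * (leverage F q d a $ i - 1 / U $ i)))) (at U within P)"
    by (intro has_derivative_eq_rhs[OF diff] ext)
  have real_f: "real_of_ereal (f_DDFact F s x V) = ?G (sc V) - (\<Sum>i\<in>UNIV. x $ i * ln (V $ i))"
    if "V \<in> P" for V
    unfolding f using finV[OF that] by (cases "Gam s (row_gram F (sc V))") auto
  have at_eq: "at U within P = at U" using UP \<open>open P\<close> by (rule at_within_open)
  have "GDERIV (\<lambda>V. real_of_ereal (f_DDFact F s x V)) U :> (\<chi> i. x $ i * (leverage F q d a $ i - 1 / U $ i))"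
    using has_derivative_transform[OF UP real_f der_diff] unfolding gderiv_def at_eq .
  moreover have "\<forall>\<^sub>F V in nhds U. \<bar>f_DDFact F s x V\<bar> \<noteq> \<infinity>"
    unfolding eventually_nhds
  proof (intro exI[of _ P] conjI ballI)
    fix V assume "V \<in> P"
    from finV[OF this] show "\<bar>f_DDFact F s x V\<bar> \<noteq> \<infinity>"
      unfolding f by (cases "Gam s (row_gram F (sc V))") auto
  qed (use \<open>open P\<close> UP in auto)
  ultimately have "ereal_gradient_at (\<lambda>V. f_DDFact F s x V) U
      (\<chi> i. x $ i * (leverage F q d a $ i - 1 / U $ i))"
    unfolding ereal_gradient_at_def by blast
  with a der show ?thesis by (rule that)
qed

text \<open>
  Euler's identity: the gradient of \<open>\<Gamma>\<close> paired with the matrix itself is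
  \<open>\<Sum>i. d i / max (d i) a\<close>, the normalized clipped sum.
\<close>

lemma leverage_total:
  assumes X: "eigensystem (row_gram F w) q d" and a: "water_level UNIV s d a"
  shows "w \<bullet> leverage F q d a = s"
proof -
  have pos: "0 < a" using a by (simp add: water_level_def)
  have "w \<bullet> leverage F q d a = (\<Sum>i\<in>UNIV. d i / max (d i) a)"
    by (simp add: eigensystem_eigenvalue(1)[OF X] flip: leverage_form)
  also have "\<dots> = (\<Sum>i\<in>UNIV. min (d i) a / a)"
    using pos by (intro sum.cong) (auto simp: min_def max_def)
  also have "\<dots> = s" using a by (simp add: water_level_def flip: sum_divide_distrib)
  finally show ?thesis .
qed

text \<open>
  For \<open>z = \<Theta> f\<close>, with \<open>\<Theta>\<close> the gradient matrix and \<open>f\<close> row \<open>j\<close>, the Gram form at \<open>z\<close> is at least its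
  \<open>j\<close>-th term \<open>w j g\<^sup>2\<close>, where \<open>g = f \<bullet> \<Theta> f\<close>, and at most \<open>z \<bullet> f = g\<close> because \<open>\<Theta> X \<Theta> \<le> \<Theta>\<close>.
\<close>

lemma leverage_le:
  assumes X: "eigensystem (row_gram F w) q d" and w: "\<And>i. 0 \<le> w $ i" and a: "0 < a"
  shows "w $ j * leverage F q d a $ j \<le> 1"
proof -
  let ?f = "row j F" and ?g = "leverage F q d a $ j" and ?m = "\<lambda>i. max (d i) a"
  have pm: "0 < ?m i" for i using a by auto
  define z where "z = (\<Sum>i\<in>UNIV. ((?f \<bullet> q i) / ?m i) *\<^sub>R q i)"
  have qz: "q i \<bullet> z = (?f \<bullet> q i) / ?m i" for i
    using X by (simp add: z_def inner_sum_right eigensystem_def if_distrib[where f="\<lambda>x. _ * x"] cong: if_cong)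
  have g: "?f \<bullet> z = ?g" by (simp add: z_def leverage_def inner_sum_right power2_eq_square)
  have g0: "0 \<le> ?g" using pm by (auto simp: leverage_def intro!: sum_nonneg divide_nonneg_pos)
  have "w $ j * ?g\<^sup>2 \<le> (\<Sum>i\<in>UNIV. w $ i * (row i F \<bullet> z)\<^sup>2)"
    using member_le_sum[of j UNIV "\<lambda>i. w $ i * (row i F \<bullet> z)\<^sup>2"] w by (simp add: g)
  also have "\<dots> = (\<Sum>i\<in>UNIV. d i * ((?f \<bullet> q i) / ?m i)\<^sup>2)"
    by (simp add: eigensystem_quadratic_form[OF X] qz flip: row_gram_form)
  also have "\<dots> \<le> (\<Sum>i\<in>UNIV. ?m i * ((?f \<bullet> q i) / ?m i)\<^sup>2)"
    by (intro sum_mono mult_right_mono) auto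
  also have "\<dots> = ?g"
    using pm by (auto simp: leverage_def power2_eq_square less_imp_neq[symmetric] intro!: sum.cong)
  finally have "(w $ j * ?g) * ?g \<le> 1 * ?g" by (simp add: power2_eq_square mult_ac)
  then show ?thesis using g0 by (cases "?g = 0") (auto simp: mult_le_cancel_right)
qed

text \<open>
  Moving mass from \<open>i\<close> to \<open>j\<close> keeps the total and, for small steps, the support, so the derivative
  applies along this segment. If \<open>x i = 1\<close>, only forward steps are feasible, which is why the
  conclusion is an inequality.
\<close>

lemma leverage_exchange:
  fixes F :: "real^'k^'n"
  assumes s: "0 < s" "s \<le> CARD('k)" and x: "x \<in> feasible_MESP s"
    and max: "\<And>y. y \<in> feasible_MESP s \<Longrightarrow> Gam s (row_gram F y) \<le> Gam s (row_gram F x)"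
    and fin: "\<bar>Gam s (row_gram F x)\<bar> \<noteq> \<infinity>"
    and der: "((\<lambda>w. real_of_ereal (Gam s (row_gram F w))) has_derivative (\<lambda>h. h \<bullet> g))
      (at x within same_support x)"
    and i: "0 < x $ i" and j: "0 < x $ j" "x $ j < 1"
  shows "g $ j \<le> g $ i"
proof (rule ccontr)
  assume gt: "\<not> g $ j \<le> g $ i"
  then have ij: "i \<noteq> j" by auto
  have x01: "0 \<le> x $ l" "x $ l \<le> 1" for l using x by (auto simp: feasible_MESP_def less_eq_vec_def)
  have sum: "1 \<bullet> x = real s" using x by (simp add: feasible_MESP_def)
  define v :: "real^'n" where "v = axis j 1 - axis i 1"
  define p where "p = (\<lambda>t. x + t *\<^sub>R v)"
  have p: "p t $ l = x $ l + (if l = j then t else if l = i then - t else 0)" for t l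
    using ij by (simp add: p_def v_def axis_def)
  \<comment> \<open>The segment keeps the support on both sides of 0 up to \<open>c\<close>; feasibility is needed only for \<open>t > 0\<close>.\<close>
  define c where "c = min (x $ i) (min (x $ j) (1 - x $ j))"
  have c: "0 < c" "c \<le> x $ i" "c \<le> x $ j" "c \<le> 1 - x $ j" using i j by (auto simp: c_def)
  have supp: "p t \<in> same_support x" if "t \<in> {-c<..<c}" for t
    using that c x01 by (auto simp: same_support_def p)
  have feas: "p t \<in> feasible_MESP s" if "0 < t" "t < c" for t
  proof -
    have "1 \<bullet> p t = real s"
      using sum by (simp add: p_def v_def inner_add_right inner_diff_right inner_axis)
    moreover have "0 \<le> p t $ l \<and> p t $ l \<le> 1" for l
      using that c x01[of l] by (auto simp: p)
    ultimately show ?thesis by (simp add: feasible_MESP_def less_eq_vec_def)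
  qed
  let ?G = "\<lambda>w. real_of_ereal (Gam s (row_gram F w))"
  have p0: "p 0 = x" by (simp add: p_def)
  have "(p has_derivative (\<lambda>t. t *\<^sub>R v)) (at 0 within {-c<..<c})"
    unfolding p_def by (auto intro!: derivative_eq_intros)
  moreover have "(?G has_derivative (\<lambda>h. h \<bullet> g)) (at (p 0) within p ` {-c<..<c})"
    unfolding p0 using der supp by (auto intro: has_derivative_subset)
  ultimately have "((\<lambda>t. ?G (p t)) has_derivative (\<lambda>t. (t *\<^sub>R v) \<bullet> g)) (at 0 within {-c<..<c})"
    by (rule has_derivative_in_compose)
  moreover have "at 0 within {-c<..<c} = at (0 :: real)"
    using c(1) by (intro at_within_open) auto
  ultimately have "((\<lambda>t. ?G (p t)) has_derivative (\<lambda>t. t * (v \<bullet> g))) (at 0)"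
    by (simp only: inner_scaleR_left)
  moreover have "v \<bullet> g = g $ j - g $ i" by (simp add: v_def inner_diff_left inner_axis')
  ultimately have "((\<lambda>t. ?G (p t)) has_real_derivative (g $ j - g $ i)) (at 0)"
    by (simp add: has_field_derivative_def mult_commute_abs)
  then obtain \<delta> where delta: "0 < \<delta>" "\<And>h. 0 < h \<Longrightarrow> h < \<delta> \<Longrightarrow> ?G (p 0) < ?G (p (0 + h))"
    using DERIV_pos_inc_right[of "\<lambda>t. ?G (p t)" "g $ j - g $ i" 0] gt by auto
  define h where "h = min \<delta> c / 2"
  have h: "0 < h" "h < \<delta>" "h < c" using delta(1) c(1) by (auto simp: h_def)
  have xx: "x \<in> same_support x" using supp[of 0] c p0 by simp
  have "\<bar>Gam s (row_gram F (p h))\<bar> \<noteq> \<infinity>"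
    using Gam_finite_same_support[OF s xx supp fin] h c by auto
  moreover have "Gam s (row_gram F (p h)) \<le> Gam s (row_gram F x)" using max feas h by simp
  ultimately have "?G (p h) \<le> ?G x"
    using fin by (cases "Gam s (row_gram F (p h))"; cases "Gam s (row_gram F x)") auto
  then show False using delta(2)[OF h(1,2)] p0 by simp
qed

lemma optimal_leverage_eq_1:
  fixes F :: "real^'k^'n"
  assumes s: "0 < s" "s \<le> CARD('k)" and x: "x \<in> feasible_MESP s"
    and max: "\<And>y. y \<in> feasible_MESP s \<Longrightarrow> Gam s (row_gram F y) \<le> Gam s (row_gram F x)"
    and fin: "\<bar>Gam s (row_gram F x)\<bar> \<noteq> \<infinity>"
    and X: "eigensystem (row_gram F x) q d" and a: "water_level UNIV s d a"
    and der: "((\<lambda>w. real_of_ereal (Gam s (row_gram F w))) has_derivative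
      (\<lambda>h. h \<bullet> leverage F q d a)) (at x within same_support x)"
    and j: "x $ j \<noteq> 0"
  shows "leverage F q d a $ j = 1"
proof -
  let ?g = "leverage F q d a"
  have x01: "0 \<le> x $ l" "x $ l \<le> 1" for l using x by (auto simp: feasible_MESP_def less_eq_vec_def)
  have "(\<Sum>l\<in>UNIV. x $ l * (1 - ?g $ l)) = 1 \<bullet> x - x \<bullet> ?g"
    by (simp add: inner_vec_def right_diff_distrib sum_subtractf)
  also have "\<dots> = 0" using x leverage_total[OF X a] by (simp add: feasible_MESP_def)
  finally have total: "(\<Sum>l\<in>UNIV. x $ l * (1 - ?g $ l)) = 0" .
  have le: "?g $ l \<le> 1" if l: "x $ l \<noteq> 0" for l
  proof (rule ccontr)
    assume gt: "\<not> ?g $ l \<le> 1"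
    have xl: "0 < x $ l" using x01(1)[of l] l by simp
    have "x $ l \<noteq> 1"
      using leverage_le[OF X x01(1), of a l] a gt by (auto simp: water_level_def)
    then have xl1: "x $ l < 1" using x01(2)[of l] by simp
    have all: "x $ i * (1 - ?g $ i) \<le> 0" for i
    proof (cases "x $ i = 0")
      case False
      then have "0 < x $ i" using x01(1)[of i] by simp
      with leverage_exchange[OF s x max fin der this xl xl1] gt show ?thesis
        by (intro mult_nonneg_nonpos) auto
    qed simp
    have "x $ l * (1 - ?g $ l) < 0" using xl gt by (simp add: mult_pos_neg)
    then have "(\<Sum>l\<in>UNIV. x $ l * (1 - ?g $ l)) < (\<Sum>l\<in>(UNIV :: 'n set). 0)"
      by (intro sum_strict_mono_strong[of _ l]) (auto simp: all)
    then show False using total by simp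
  qed
  have "0 \<le> x $ l * (1 - ?g $ l)" for l
    using le[of l] x01(1)[of l] by (cases "x $ l = 0") auto
  then have "x $ j * (1 - ?g $ j) = 0"
    using total by (subst (asm) sum_nonneg_eq_0_iff) auto
  then show ?thesis using j by simp
qed

text \<open>
  Guarantees that the maximum is not \<open>-\<infinity>\<close>: at the uniform point all weights are positive, so the
  Gram matrix has the kernel, hence the rank, of \<open>F\<close>.
\<close>

lemma uniform_point_finite:
  fixes F :: "real^'k^'n" and s :: nat
  defines "y \<equiv> \<chi> i. real s / CARD('n)"
  assumes s: "0 < s" "s \<le> CARD('k)" "s \<le> CARD('n)" and rank: "s \<le> rank F"
  shows "y \<in> feasible_MESP s" and "\<bar>Gam s (row_gram F y)\<bar> \<noteq> \<infinity>"
proof -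
  have y0: "0 \<le> y $ i" for i by (simp add: y_def)
  show "y \<in> feasible_MESP s"
    using s by (simp add: feasible_MESP_def y_def less_eq_vec_def inner_vec_def)
  obtain q d where X: "eigensystem (row_gram F y) q d" and d: "\<And>i. 0 \<le> d i"
    using row_gram_eigensystem[of y F] y0 by blast
  have "F *v v = 0" if "row_gram F y *v v = 0" for v
  proof -
    have "row i F \<bullet> v = 0" for i
      using that s by (simp add: row_gram_kernel[OF y0]) (simp add: y_def)
    then show ?thesis by (simp add: vec_eq_iff matrix_vector_mult_def row_def inner_vec_def)
  qed
  then have "rank F \<le> card {i. d i \<noteq> 0}" by (rule rank_le_nonzero_eigenvalues[OF X])
  also have "{i. d i \<noteq> 0} = {i. 0 < d i}" using d by (auto simp: less_le)
  finally show "\<bar>Gam s (row_gram F y)\<bar> \<noteq> \<infinity>"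
    using Gam_eigensystem(2)[OF X d s(1,2)] rank by simp
qed

theorem theorem5:
  fixes C :: "real^'n^'n" and F :: "real^'k^'n" and A :: "real^'n^'m" and b :: "real^'m"
    and s :: nat
  assumes "1 < CARD('n)" and "0 < s" and "s < CARD('n)"
    and "sym_psd C" and "s \<le> rank C"
    and "C = F ** transpose F" and "rank C \<le> CARD('k)" and "CARD('k) \<le> CARD('n)"
  shows "(\<forall>x \<in> feasible s A b. \<forall>U\<^sub>0. positive_vec U\<^sub>0 \<and> x \<in> dom_DDFact F s U\<^sub>0 \<longrightarrow>
            (\<forall>U. positive_vec U \<longrightarrow> ereal_differentiable_at (\<lambda>V. f_DDFact F s x V) U))
       \<and> (\<forall>x. is_arg_max (\<lambda>y. f_DDFact F s y 1) (\<lambda>y. y \<in> feasible_MESP s) x \<longrightarrow>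
            ereal_gradient_at (\<lambda>V. f_DDFact F s x V) 1 0)"
proof (intro conjI ballI allI impI)
  have s: "0 < s" "s \<le> CARD('k)" using assms by auto
  {
    fix x U\<^sub>0 U :: "real^'n"
    assume x: "x \<in> feasible s A b" and U0: "positive_vec U\<^sub>0 \<and> x \<in> dom_DDFact F s U\<^sub>0"
      and U: "positive_vec U"
    have x0: "0 \<le> x $ i" for i
      using x by (simp add: feasible_def feasible_MESP_def less_eq_vec_def)
    let ?start = "\<chi> i. U\<^sub>0 $ i * x $ i" and ?w = "\<chi> i. U $ i * x $ i"
    have "\<bar>Gam s (row_gram F ?start)\<bar> \<noteq> \<infinity>"
      using U0 by (cases "Gam s (row_gram F ?start)")
        (auto simp: dom_DDFact_def f_DDFact_def F_DDFact_row_gram[of F x U\<^sub>0])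
    moreover have "0 < U $ i" "0 < U\<^sub>0 $ i" for i using U U0 by (auto simp: positive_vec_def)
    then have "?start \<in> same_support ?start" "?w \<in> same_support ?start"
      using x0 by (auto simp: same_support_def less_imp_le less_imp_neq[symmetric])
    ultimately have fin: "\<bar>Gam s (row_gram F ?w)\<bar> \<noteq> \<infinity>"
      by (rule Gam_finite_same_support[OF s, rotated 2])
    obtain q d where X: "eigensystem (row_gram F ?w) q d"
      using symmetric_eigensystem[OF transpose_row_gram] by blast
    obtain D where "ereal_gradient_at (\<lambda>V. f_DDFact F s x V) U D"
      using f_DDFact_gradient[OF s x0 U fin X] by blast
    then show "ereal_differentiable_at (\<lambda>V. f_DDFact F s x V) U"
      unfolding ereal_gradient_at_def ereal_differentiable_at_def gderiv_def differentiable_def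
      by blast
  }
  fix x :: "real^'n"
  assume "is_arg_max (\<lambda>y. f_DDFact F s y 1) (\<lambda>y. y \<in> feasible_MESP s) x"
  then have x: "x \<in> feasible_MESP s"
    and max: "\<And>y. y \<in> feasible_MESP s \<Longrightarrow> Gam s (row_gram F y) \<le> Gam s (row_gram F x)"
    by (auto simp: is_arg_max_linorder f_DDFact_def zero_ereal_def[symmetric])
  have x0: "0 \<le> x $ i" for i using x by (simp add: feasible_MESP_def less_eq_vec_def)
  obtain q d where X: "eigensystem (row_gram F x) q d" and d: "\<And>i. 0 \<le> d i"
    using row_gram_eigensystem[OF x0] by blast
  have "s \<le> rank F" using assms(5,6) rank_mul_le_left[of F "transpose F"] by simp
  from uniform_point_finite[OF s _ this] max Gam_eigensystem(4)[OF X d s] assms(3)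
  have fin: "\<bar>Gam s (row_gram F x)\<bar> \<noteq> \<infinity>" by force
  have one: "positive_vec (1 :: real^'n)" by (simp add: positive_vec_def)
  have w: "(\<chi> i. (1 :: real^'n) $ i * x $ i) = x" by simp
  obtain a where a: "water_level UNIV s d a"
    and der: "((\<lambda>w. real_of_ereal (Gam s (row_gram F w))) has_derivative
      (\<lambda>h. h \<bullet> leverage F q d a)) (at x within same_support x)"
    and grad: "ereal_gradient_at (\<lambda>V. f_DDFact F s x V) 1
      (\<chi> i. x $ i * (leverage F q d a $ i - 1 / (1 :: real^'n) $ i))"
    using f_DDFact_gradient[OF s x0 one, unfolded w, OF fin X] by blast
  have "x $ i * (leverage F q d a $ i - 1 / (1 :: real^'n) $ i) = 0" for i
    using optimal_leverage_eq_1[OF s x max fin X a der, of i] by (cases "x $ i = 0") auto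
  then have "(\<chi> i. x $ i * (leverage F q d a $ i - 1 / (1 :: real^'n) $ i)) = 0"
    by (simp add: vec_eq_iff)
  with grad show "ereal_gradient_at (\<lambda>V. f_DDFact F s x V) 1 0" by simp
qed

end
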